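(* Assuming $\exists^2$, a Cantor realiser is Kleene-computable from any functional performing any one of the following tasks: (1) for $f:[0,1]\rightarrow\mathbb{Q}$ of bounded variation, find $x,y\in[0,1]$ with $x\neq y$ and $f(x)=f(y)$; (2) for $f:[0,1]\rightarrow\mathbb{R}$ of bounded variation, find a point of continuity of $f$ in $[0,1]$; (3) for $f:[0,1]\rightarrow[0,1]$ which is Riemann integrable (or has bounded variation) with $\int_0^1f(x)\,dx=0$, find $y\in[0,1]$ with $f(y)=0$; (4) for $f,g:\mathbb{R}\rightarrow\mathbb{R}$ such that $f,g$ have bounded variation on $[0,a]$ for every $a>0$ and such that $\mathfrak{L}(f)$ and $\mathfrak{L}(g)$ exist and are equal on $[0,+\infty)$, find $x\in(0,\infty)$ with $f(x)=g(x)$. Moreover, any NIN-realiser computes a functional performing task (1). Finally, assuming $\exists^2$, a weak Cantor realiser is Kleene-computable from any functional performing any one of the tasks (1)–(4) in which "bounded variation" is replaced by "has a variation".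
   Context: Computability is Kleene's higher-order computability via S1–S9; metatheory ZFC. Sets are given by characteristic functions. Kleene's $\exists^2$ is $\varphi:\mathbb{N}^{\mathbb{N}}\rightarrow\{0,1\}$ with $\varphi(f)=0\leftrightarrow(\exists n)(f(n)=0)$. A function $f:[a,b]\rightarrow\mathbb{R}$ has bounded variation if there is $k_0\in\mathbb{N}$ with $k_0\geq\sum_i|f(x_i)-f(x_{i+1})|$ for every partition $a=x_0<\dots<x_n=b$; it has a variation if the supremum $V_a^b(f)=\sup_{a\leq x_0<\dots<x_n\leq b}\sum_i|f(x_i)-f(x_{i+1})|$ exists and is finite. The Laplace transform is $\mathfrak{L}(f)(s)=\int_0^{+\infty}e^{-st}f(t)\,dt$, interpreted as the limit of Riemann integrals $\int_0^N$ as $N\to\infty$, if it exists. $Y:[0,1]\rightarrow\mathbb{N}$ is injective on $A$ if $(\forall x,y\in A)(Y(x)=Y(y)\rightarrow x=y)$, and bijective on $A$ if moreover $(\forall n)(\exists x\in A)(Y(x)=n)$. A Cantor realiser takes as input $A\subseteq[0,1]$ and $Y:[0,1]\rightarrow\mathbb{N}$ injective on $A$ and outputs some $x\in[0,1]\setminus A$; a weak Cantor realiser does the same for inputs with $Y$ bijective on $A$. A NIN-realiser takes as input any $Y:[0,1]\rightarrow\mathbb{N}$ and outputs $x,y\in[0,1]$ with $x\neq y$ and $Y(x)=Y(y)$. *)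

theory Defs
  imports "HOL-Analysis.Analysis" "HOL-Library.Nat_Bijection" "HOL-Library.Lub_Glb"
begin

section \<open>Kleene computability via S1--S9\<close>

text \<open>
  Objects of finite type up to level three over the full set-theoretic hierarchy. Every finite type
  is of the form \<open>\<sigma>\<^sub>1 \<rightarrow> \<dots> \<rightarrow> \<sigma>\<^sub>k \<rightarrow> 0\<close>. Below level three the types \<open>0\<close>, \<open>1\<close>, \<open>2\<close> and \<open>1 \<rightarrow> 1\<close> are
  used. A functional of level three is partial and takes a list of arguments whose types are
  prescribed by its signature; functionals with values of type \<open>1\<close> are uncurried.
\<close>

datatype ty = Ty0 | Ty1 | Ty2 | Ty11

datatype low =
    Num nat
  | Fun "nat \<Rightarrow> nat"
  | Fnl "(nat \<Rightarrow> nat) \<Rightarrow> nat"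
  | Op "(nat \<Rightarrow> nat) \<Rightarrow> nat \<Rightarrow> nat"

fun ty_of :: "low \<Rightarrow> ty" where
  "ty_of (Num n) = Ty0"
| "ty_of (Fun f) = Ty1"
| "ty_of (Fnl F) = Ty2"
| "ty_of (Op F) = Ty11"

type_synonym functional3 = "low list \<Rightarrow> nat option"

datatype obj = Low low | Fnl3 "ty list" functional3

fun obj_app :: "obj \<Rightarrow> low list \<Rightarrow> nat option" where
  "obj_app (Low (Fnl F)) [Fun f] = Some (F f)"
| "obj_app (Low (Op F)) [Fun f, Num n] = Some (F f n)"
| "obj_app (Fnl3 \<sigma> F) xs = (if map ty_of xs = \<sigma> then F xs else None)"
| "obj_app _ _ = None"

text \<open>
  \<open>kleene e args m\<close> is \<open>{e}(args) \<simeq> m\<close>; \<open>denotes d args x\<close> says that \<open>x\<close> is the (total)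
  object \<open>\<lambda>\<xi>. {d}(\<xi>, args)\<close>. As usual, S8 requires the argument objects to be total and, for a
  partial functional, to lie in its domain. S8 is stated for arbitrary signatures; for
  pure types it is \<open>{e}(\<Phi>, args) \<simeq> \<Phi>(\<lambda>\<xi>. {d}(\<xi>, \<Phi>, args))\<close>.
\<close>

inductive kleene :: "nat \<Rightarrow> obj list \<Rightarrow> nat \<Rightarrow> bool"
  and denotes :: "nat \<Rightarrow> obj list \<Rightarrow> low \<Rightarrow> bool"
where
  S1: "kleene (list_encode [1]) (Low (Num n) # args) (Suc n)"
| S2: "kleene (list_encode [2, q]) args q"
| S3: "kleene (list_encode [3]) (Low (Num n) # args) n"
| S4: "\<lbrakk>kleene e2 args k; kleene e1 (Low (Num k) # args) m\<rbrakk>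
        \<Longrightarrow> kleene (list_encode [4, e1, e2]) args m"
| S5_0: "kleene e1 args m \<Longrightarrow> kleene (list_encode [5, e1, e2]) (Low (Num 0) # args) m"
| S5_Suc: "\<lbrakk>kleene (list_encode [5, e1, e2]) (Low (Num n) # args) k;
            kleene e2 (Low (Num n) # Low (Num k) # args) m\<rbrakk>
        \<Longrightarrow> kleene (list_encode [5, e1, e2]) (Low (Num (Suc n)) # args) m"
| S6: "\<lbrakk>distinct p; set p = {..<length args}; kleene e1 (map ((!) args) p) m\<rbrakk>
        \<Longrightarrow> kleene (list_encode [6, list_encode p, e1]) args m"
| S7: "kleene (list_encode [7]) (Low (Fun f) # Low (Num n) # args) (f n)"
| S8: "\<lbrakk>list_all2 (\<lambda>d x. denotes d (\<Phi> # args) x) ds xs; obj_app \<Phi> xs = Some m\<rbrakk>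
        \<Longrightarrow> kleene (list_encode (8 # ds)) (\<Phi> # args) m"
| S9: "kleene d args m
        \<Longrightarrow> kleene (list_encode [9, length args]) (Low (Num d) # args @ args') m"
| den0: "kleene d args n \<Longrightarrow> denotes d args (Num n)"
| den1: "(\<And>n. kleene d (Low (Num n) # args) (f n)) \<Longrightarrow> denotes d args (Fun f)"
| den2: "(\<And>f. kleene d (Low (Fun f) # args) (F f)) \<Longrightarrow> denotes d args (Fnl F)"
| den11: "(\<And>f n. kleene d (Low (Fun f) # Low (Num n) # args) (F f n)) \<Longrightarrow> denotes d args (Op F)"

lemma list_encode_inject: "list_encode xs = list_encode ys \<longleftrightarrow> xs = ys"
  using inj_list_encode[of UNIV] by (auto dest: injD)

lemma obj_app_types:
  "obj_app \<Phi> xs = Some m \<Longrightarrow> obj_app \<Phi> ys = Some m' \<Longrightarrow> map ty_of xs = map ty_of ys"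
  by (cases "(\<Phi>, xs)" rule: obj_app.cases; cases "(\<Phi>, ys)" rule: obj_app.cases)
     (auto split: if_splits)

inductive_cases denotes_NumE: "denotes d args (Num n)"
inductive_cases denotes_FunE: "denotes d args (Fun f)"
inductive_cases denotes_FnlE: "denotes d args (Fnl F)"
inductive_cases denotes_OpE: "denotes d args (Op F)"

lemma ty_of_eq:
  "ty_of y = Ty0 \<Longrightarrow> \<exists>n. y = Num n"
  "ty_of y = Ty1 \<Longrightarrow> \<exists>f. y = Fun f"
  "ty_of y = Ty2 \<Longrightarrow> \<exists>F. y = Fnl F"
  "ty_of y = Ty11 \<Longrightarrow> \<exists>G. y = Op G"
  by (cases y; simp)+

lemma kleene_inversion:
  "kleene (list_encode [1]) (Low (Num n) # args) m \<Longrightarrow> m = Suc n"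
  "kleene (list_encode [2, q]) args m \<Longrightarrow> m = q"
  "kleene (list_encode [3]) (Low (Num n) # args) m \<Longrightarrow> m = n"
  "kleene (list_encode [4, e1, e2]) args m \<Longrightarrow> \<exists>k. kleene e2 args k \<and> kleene e1 (Low (Num k) # args) m"
  "kleene (list_encode [5, e1, e2]) (Low (Num 0) # args) m \<Longrightarrow> kleene e1 args m"
  "kleene (list_encode [5, e1, e2]) (Low (Num (Suc n)) # args) m \<Longrightarrow>
     \<exists>k. kleene (list_encode [5, e1, e2]) (Low (Num n) # args) k \<and>
         kleene e2 (Low (Num n) # Low (Num k) # args) m"
  "kleene (list_encode [6, list_encode p, e1]) args m \<Longrightarrow> kleene e1 (map ((!) args) p) m"
  "kleene (list_encode [7]) (Low (Fun f) # Low (Num n) # args) m \<Longrightarrow> m = f n"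
  "kleene (list_encode (8 # ds)) (\<Phi> # args) m \<Longrightarrow>
     \<exists>xs. list_all2 (\<lambda>d x. denotes d (\<Phi> # args) x) ds xs \<and> obj_app \<Phi> xs = Some m"
  "kleene (list_encode [9, length args]) (Low (Num d) # args @ args') m \<Longrightarrow> kleene d args m"
  by (erule kleene.cases; auto simp: list_encode_inject simp del: list_encode.simps)+

lemma kleene_deterministic:
  "kleene e args m \<Longrightarrow> (\<And>m'. kleene e args m' \<Longrightarrow> m' = m)"
  "denotes d args x \<Longrightarrow> (\<And>y. denotes d args y \<Longrightarrow> ty_of y = ty_of x \<Longrightarrow> y = x)"
proof (induction rule: kleene_denotes.inducts)
  case (S1 n args) then show ?case by (rule kleene_inversion(1))
next
  case (S2 q args) then show ?case by (rule kleene_inversion(2))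
next
  case (S3 n args) then show ?case by (rule kleene_inversion(3))
next
  case (S4 e2 args k e1 m) then show ?case using kleene_inversion(4) by blast
next
  case (S5_0 e1 args m e2) then show ?case using kleene_inversion(5) by blast
next
  case (S5_Suc e1 e2 n args k m) then show ?case using kleene_inversion(6) by blast
next
  case (S6 p args e1 m) then show ?case using kleene_inversion(7) by blast
next
  case (S7 f n args) then show ?case by (rule kleene_inversion(8))
next
  case (S8 \<Phi> args ds xs m)
  obtain ys where ys: "list_all2 (\<lambda>d x. denotes d (\<Phi> # args) x) ds ys"
    and m': "obj_app \<Phi> ys = Some m'"
    using kleene_inversion(9)[OF S8(3)] by blast
  have "map ty_of ys = map ty_of xs" using obj_app_types[OF m' S8(2)] .
  then have "ty_of (ys ! i) = ty_of (xs ! i)" if "i < length xs" for i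
    using that by (metis length_map nth_map)
  moreover have len: "length ys = length xs" using ys S8(1) by (simp add: list_all2_conv_all_nth)
  ultimately have "ys ! i = xs ! i" if "i < length xs" for i
    using S8(1) ys that unfolding list_all2_conv_all_nth by metis
  with len have "ys = xs" by (simp add: list_eq_iff_nth_eq)
  then show ?case using m' S8(2) by simp
next
  case (S9 d args m args') then show ?case using kleene_inversion(10) by blast
next
  case (den0 d args n)
  from den0.prems(2) obtain k where "y = Num k" using ty_of_eq(1) by auto
  with den0 show ?case by (blast elim: denotes_NumE)
next
  case (den1 d args f)
  from den1.prems(2) obtain g where g: "y = Fun g" using ty_of_eq(2) by auto
  then have "\<And>n. kleene d (Low (Num n) # args) (g n)" using den1.prems(1) by (blast elim: denotes_FunE)
  then have "g n = f n" for n by (rule den1.IH)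
  with g show ?case by blast
next
  case (den2 d args F)
  from den2.prems(2) obtain G where G: "y = Fnl G" using ty_of_eq(3) by auto
  then have "\<And>f. kleene d (Low (Fun f) # args) (G f)" using den2.prems(1) by (blast elim: denotes_FnlE)
  then have "G f = F f" for f by (rule den2.IH)
  with G show ?case by blast
next
  case (den11 d args F)
  from den11.prems(2) obtain G where G: "y = Op G" using ty_of_eq(4) by auto
  then have "\<And>f n. kleene d (Low (Fun f) # Low (Num n) # args) (G f n)"
    using den11.prems(1) by (blast elim: denotes_OpE)
  then have "G f n = F f n" for f n by (rule den11.IH)
  with G show ?case by blast
qed

definition kleene_computable_from :: "ty list \<Rightarrow> functional3 \<Rightarrow> obj list \<Rightarrow> bool" where
  "kleene_computable_from \<sigma> C oracles \<longleftrightarrow>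
     (\<exists>e. \<forall>xs. map ty_of xs = \<sigma> \<longrightarrow>
        (\<forall>m. kleene e (map Low xs @ oracles) m \<longleftrightarrow> C xs = Some m))"

definition exists2 :: "(nat \<Rightarrow> nat) \<Rightarrow> nat" where
  "exists2 f = (if \<exists>n. f n = 0 then 0 else 1)"

section \<open>Representations\<close>

text \<open>Rationals are coded by their reduced fractions, so that codes are unique.\<close>

definition rat_code :: "rat \<Rightarrow> nat" where
  "rat_code q = prod_encode (int_encode (fst (quotient_of q)), nat (snd (quotient_of q)))"

text \<open>Reals are given by fast-converging Cauchy sequences of rationals.\<close>

definition names :: "(nat \<Rightarrow> nat) \<Rightarrow> real \<Rightarrow> bool" where
  "names \<alpha> x \<longleftrightarrow>
     (\<exists>q :: nat \<Rightarrow> rat. (\<forall>n. \<alpha> n = rat_code (q n)) \<and> (\<forall>n i. \<bar>q n - q (n + i)\<bar> < 1 / 2 ^ n) \<and>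
        (\<lambda>n. real_of_rat (q n)) \<longlonglongrightarrow> x)"

definition represents_real :: "real set \<Rightarrow> ((nat \<Rightarrow> nat) \<Rightarrow> nat \<Rightarrow> nat) \<Rightarrow> (real \<Rightarrow> real) \<Rightarrow> bool" where
  "represents_real D F f \<longleftrightarrow> (\<forall>\<alpha> x. names \<alpha> x \<and> x \<in> D \<longrightarrow> names (F \<alpha>) (f x))"

definition represents_nat :: "real set \<Rightarrow> ((nat \<Rightarrow> nat) \<Rightarrow> nat) \<Rightarrow> (real \<Rightarrow> nat) \<Rightarrow> bool" where
  "represents_nat D F Y \<longleftrightarrow> (\<forall>\<alpha> x. names \<alpha> x \<and> x \<in> D \<longrightarrow> F \<alpha> = Y x)"

definition represents_rat :: "real set \<Rightarrow> ((nat \<Rightarrow> nat) \<Rightarrow> nat) \<Rightarrow> (real \<Rightarrow> rat) \<Rightarrow> bool" where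
  "represents_rat D F f \<longleftrightarrow> represents_nat D F (\<lambda>x. rat_code (f x))"

definition represents_set :: "real set \<Rightarrow> ((nat \<Rightarrow> nat) \<Rightarrow> nat) \<Rightarrow> real set \<Rightarrow> bool" where
  "represents_set D F A \<longleftrightarrow> represents_nat D F (\<lambda>x. if x \<in> A then 1 else 0)"

definition outputs_real :: "functional3 \<Rightarrow> low list \<Rightarrow> real \<Rightarrow> bool" where
  "outputs_real T xs x \<longleftrightarrow> (\<exists>\<alpha>. names \<alpha> x \<and> (\<forall>n. T (xs @ [Num n]) = Some (\<alpha> n)))"

text \<open>An output in \<open>\<real> \<times> \<real>\<close> is a pair of functionals, selected by an additional numerical argument.\<close>

definition outputs_real_pair :: "functional3 \<Rightarrow> low list \<Rightarrow> real \<Rightarrow> real \<Rightarrow> bool" where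
  "outputs_real_pair T xs x y \<longleftrightarrow>
     outputs_real T (xs @ [Num 0]) x \<and> outputs_real T (xs @ [Num 1]) y"

section \<open>Variation, Riemann integral and Laplace transform\<close>

definition increasing_points :: "(nat \<Rightarrow> real) \<Rightarrow> nat \<Rightarrow> bool" where
  "increasing_points x n \<longleftrightarrow> (\<forall>i<n. x i < x (Suc i))"

definition variation_sum :: "(real \<Rightarrow> real) \<Rightarrow> (nat \<Rightarrow> real) \<Rightarrow> nat \<Rightarrow> real" where
  "variation_sum f x n = (\<Sum>i<n. \<bar>f (x i) - f (x (Suc i))\<bar>)"

definition bounded_variation :: "real \<Rightarrow> real \<Rightarrow> (real \<Rightarrow> real) \<Rightarrow> bool" where
  "bounded_variation a b f \<longleftrightarrow>
     (\<exists>k\<^sub>0 :: nat. \<forall>x n. increasing_points x n \<and> x 0 = a \<and> x n = b \<longrightarrow> variation_sum f x n \<le> real k\<^sub>0)"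

definition has_variation :: "real \<Rightarrow> real \<Rightarrow> (real \<Rightarrow> real) \<Rightarrow> bool" where
  "has_variation a b f \<longleftrightarrow>
     (\<exists>V. isLub UNIV {variation_sum f x n |x n. increasing_points x n \<and> a \<le> x 0 \<and> x n \<le> b} V)"

text \<open>The library's integral is the strictly more general gauge integral.\<close>

definition has_riemann_integral :: "(real \<Rightarrow> real) \<Rightarrow> real \<Rightarrow> real \<Rightarrow> real \<Rightarrow> bool" where
  "has_riemann_integral f a b I \<longleftrightarrow>
     (\<forall>\<epsilon>>0. \<exists>\<delta>>0. \<forall>x t n.
        increasing_points x n \<and> x 0 = a \<and> x n = b \<and>
        (\<forall>i<n. x i \<le> t i \<and> t i \<le> x (Suc i) \<and> x (Suc i) - x i < \<delta>) \<longrightarrow>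
        \<bar>(\<Sum>i<n. f (t i) * (x (Suc i) - x i)) - I\<bar> < \<epsilon>)"

definition riemann_integrable :: "real \<Rightarrow> real \<Rightarrow> (real \<Rightarrow> real) \<Rightarrow> bool" where
  "riemann_integrable a b f \<longleftrightarrow> (\<exists>I. has_riemann_integral f a b I)"

definition has_laplace_transform :: "(real \<Rightarrow> real) \<Rightarrow> real \<Rightarrow> real \<Rightarrow> bool" where
  "has_laplace_transform f s L \<longleftrightarrow>
     (\<exists>J :: real \<Rightarrow> real.
        (\<forall>N>0. has_riemann_integral (\<lambda>t. exp (- s * t) * f t) 0 N (J N)) \<and> (J \<longlongrightarrow> L) at_top)"

section \<open>Realisers and tasks\<close>

definition cantor_realiser :: "functional3 \<Rightarrow> bool" where
  "cantor_realiser C \<longleftrightarrow>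
     (\<forall>F\<^sub>A F\<^sub>Y A Y. A \<subseteq> {0..1} \<and> represents_set {0..1} F\<^sub>A A \<and> represents_nat {0..1} F\<^sub>Y Y \<and> inj_on Y A \<longrightarrow>
        (\<exists>x \<in> {0..1} - A. outputs_real C [Fnl F\<^sub>A, Fnl F\<^sub>Y] x))"

definition weak_cantor_realiser :: "functional3 \<Rightarrow> bool" where
  "weak_cantor_realiser C \<longleftrightarrow>
     (\<forall>F\<^sub>A F\<^sub>Y A Y. A \<subseteq> {0..1} \<and> represents_set {0..1} F\<^sub>A A \<and> represents_nat {0..1} F\<^sub>Y Y \<and>
          bij_betw Y A UNIV \<longrightarrow>
        (\<exists>x \<in> {0..1} - A. outputs_real C [Fnl F\<^sub>A, Fnl F\<^sub>Y] x))"

definition nin_realiser :: "functional3 \<Rightarrow> bool" where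
  "nin_realiser T \<longleftrightarrow>
     (\<forall>F Y. represents_nat {0..1} F Y \<longrightarrow>
        (\<exists>x \<in> {0..1}. \<exists>y \<in> {0..1}. x \<noteq> y \<and> Y x = Y y \<and> outputs_real_pair T [Fnl F] x y))"

text \<open>
  The parameter \<open>V\<close> is \<^const>\<open>bounded_variation\<close> or \<^const>\<open>has_variation\<close>; in \<open>task3\<close> it can also
  be \<^const>\<open>riemann_integrable\<close>.
\<close>

definition task1 :: "(real \<Rightarrow> real \<Rightarrow> (real \<Rightarrow> real) \<Rightarrow> bool) \<Rightarrow> functional3 \<Rightarrow> bool" where
  "task1 V T \<longleftrightarrow>
     (\<forall>F f. represents_rat {0..1} F f \<and> V 0 1 (\<lambda>x. real_of_rat (f x)) \<longrightarrow>
        (\<exists>x \<in> {0..1}. \<exists>y \<in> {0..1}. x \<noteq> y \<and> f x = f y \<and> outputs_real_pair T [Fnl F] x y))"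

definition task2 :: "(real \<Rightarrow> real \<Rightarrow> (real \<Rightarrow> real) \<Rightarrow> bool) \<Rightarrow> functional3 \<Rightarrow> bool" where
  "task2 V T \<longleftrightarrow>
     (\<forall>F f. represents_real {0..1} F f \<and> V 0 1 f \<longrightarrow>
        (\<exists>x \<in> {0..1}. continuous (at x within {0..1}) f \<and> outputs_real T [Op F] x))"

definition task3 :: "(real \<Rightarrow> real \<Rightarrow> (real \<Rightarrow> real) \<Rightarrow> bool) \<Rightarrow> functional3 \<Rightarrow> bool" where
  "task3 V T \<longleftrightarrow>
     (\<forall>F f. represents_real {0..1} F f \<and> f ` {0..1} \<subseteq> {0..1} \<and> V 0 1 f \<and>
          has_riemann_integral f 0 1 0 \<longrightarrow>
        (\<exists>y \<in> {0..1}. f y = 0 \<and> outputs_real T [Op F] y))"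

definition task4 :: "(real \<Rightarrow> real \<Rightarrow> (real \<Rightarrow> real) \<Rightarrow> bool) \<Rightarrow> functional3 \<Rightarrow> bool" where
  "task4 V T \<longleftrightarrow>
     (\<forall>F G f g. represents_real UNIV F f \<and> represents_real UNIV G g \<and>
          (\<forall>a>0. V 0 a f \<and> V 0 a g) \<and>
          (\<forall>s\<ge>0. \<exists>L. has_laplace_transform f s L \<and> has_laplace_transform g s L) \<longrightarrow>
        (\<exists>x>0. f x = g x \<and> outputs_real T [Op F, Op G] x))"

abbreviation "sig_pair \<equiv> [Ty2, Ty0, Ty0]"
abbreviation "sig_real \<equiv> [Ty11, Ty0]"
abbreviation "sig_real2 \<equiv> [Ty11, Ty11, Ty0]"
abbreviation "sig_cantor \<equiv> [Ty2, Ty2, Ty0]"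

definition computes_with_exists2 ::
  "ty list \<Rightarrow> functional3 \<Rightarrow> ty list \<Rightarrow> (functional3 \<Rightarrow> bool) \<Rightarrow> bool" where
  "computes_with_exists2 \<tau> T \<sigma> P \<longleftrightarrow>
     (\<exists>C. P C \<and> kleene_computable_from \<sigma> C [Fnl3 \<tau> T, Low (Fnl exists2)])"

end

theory Submission
  imports Defs
begin

text \<open>
  Given \<open>A\<close> and \<open>Y\<close> injective on \<open>A\<close>, let \<open>w\<close> be \<open>2\<^bsup>-Y(x)\<^esup>\<close> on \<open>A\<close> and \<open>0\<close> elsewhere. The values of
  \<open>w\<close> are summable, since they are distinct terms of a geometric series. A summable function has
  bounded variation and Riemann integral \<open>0\<close>, and it vanishes wherever it is continuous because its
  support is countable. Moreover \<open>w\<close> is injective on \<open>A\<close>, so solutions of tasks (1)--(3) for \<open>w\<close>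
  lie outside \<open>A\<close>. For task (4) the line is folded into \<open>[0,1)\<close> by \<open>\<phi>(x) = \<bar>x\<bar> / (1 + \<bar>x\<bar>)\<close>: the
  functions \<open>w \<circ> \<phi>\<close> and \<open>0\<close> have the same Laplace transform, and \<open>\<phi>\<close> maps a point where they
  agree to a point outside \<open>A\<close>. A NIN-realiser applied to codes of rationals already performs
  task (1).
\<close>

section \<open>Uniform Kleene computability\<close>

text \<open>
  One index serves all parameters \<open>p\<close>; the length of the argument list is fixed because the
  permutations in S6 and the cut-off in S9 refer to it. Nothing is required where \<open>f\<close> is undefined:
  an oracle is only known to return a value on inputs for which its task is posed.
\<close>

definition partially_computable :: "('p \<Rightarrow> obj list) \<Rightarrow> ('p \<Rightarrow> nat option) \<Rightarrow> bool" where
  "partially_computable A f \<longleftrightarrow>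
     (\<exists>k e. \<forall>p. length (A p) = k \<and> (\<forall>m. f p = Some m \<longrightarrow> kleene e (A p) m))"

abbreviation computable :: "('p \<Rightarrow> obj list) \<Rightarrow> ('p \<Rightarrow> nat) \<Rightarrow> bool" where
  "computable A f \<equiv> partially_computable A (\<lambda>p. Some (f p))"

abbreviation computable1 :: "(nat \<Rightarrow> nat) \<Rightarrow> bool" where
  "computable1 g \<equiv> computable (\<lambda>n. [Low (Num n)]) g"

abbreviation computable2 :: "(nat \<Rightarrow> nat \<Rightarrow> nat) \<Rightarrow> bool" where
  "computable2 g \<equiv> computable (\<lambda>(m, n). [Low (Num m), Low (Num n)]) (\<lambda>(m, n). g m n)"

lemma partially_computableI:
  assumes "\<And>p. length (A p) = k" "\<And>p m. f p = Some m \<Longrightarrow> kleene e (A p) m"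
  shows "partially_computable A f"
  unfolding partially_computable_def using assms by blast

lemma partially_computable_reparam:
  "partially_computable A f \<Longrightarrow> partially_computable (\<lambda>p. A (h p)) (\<lambda>p. f (h p))"
  unfolding partially_computable_def by blast

text \<open>S6 only permutes; arguments are discarded by S9, applied to an index supplied by S2.\<close>

lemma kleene_append:
  assumes "kleene d args m"
  shows "kleene (list_encode [4, list_encode [9, length args], list_encode [2, d]])
    (args @ args') m"
  by (rule S4, rule S2, rule S9, rule assms)

definition subcontext :: "('p \<Rightarrow> obj list) \<Rightarrow> ('p \<Rightarrow> obj list) \<Rightarrow> bool" where
  "subcontext B A \<longleftrightarrow> (\<exists>k q. distinct q \<and> set q \<subseteq> {..<k} \<and>
     (\<forall>p. length (A p) = k \<and> map ((!) (A p)) q = B p))"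

lemma subcontextI:
  assumes "distinct q" "set q \<subseteq> {..<k}" "\<And>p. length (A p) = k" "\<And>p. map ((!) (A p)) q = B p"
  shows "subcontext B A"
  unfolding subcontext_def using assms by blast

lemma partially_computable_subcontext:
  assumes "partially_computable B f" "subcontext B A"
  shows "partially_computable A f"
proof -
  obtain e where e: "\<And>p m. f p = Some m \<Longrightarrow> kleene e (B p) m"
    using assms(1) unfolding partially_computable_def by blast
  obtain k q where q: "distinct q" "set q \<subseteq> {..<k}" "\<And>p. length (A p) = k"
      "\<And>p. map ((!) (A p)) q = B p"
    using assms(2) unfolding subcontext_def by blast
  define r where "r = filter (\<lambda>i. i \<notin> set q) [0..<k]"
  let ?d = "list_encode [4, list_encode [9, length q], list_encode [2, e]]"
  have "kleene (list_encode [6, list_encode (q @ r), ?d]) (A p) m" if "f p = Some m" for p m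
  proof (rule S6)
    show "distinct (q @ r)" using q(1) by (auto simp: r_def)
    show "set (q @ r) = {..<length (A p)}" using q(2,3) by (auto simp: r_def)
    have "kleene e (map ((!) (A p)) q) m" using e[OF that] q(4) by simp
    from kleene_append[OF this, of "map ((!) (A p)) r"]
    show "kleene ?d (map ((!) (A p)) (q @ r)) m" by simp
  qed
  with q(3) show ?thesis by (rule partially_computableI)
qed

lemma subcontext_Cons:
  assumes "\<And>p. length (A p) = k"
  shows "subcontext A (\<lambda>p. x p # A p)"
proof (rule subcontextI)
  show "map ((!) (x p # A p)) [1..<Suc k] = A p" for p
    by (rule nth_equalityI) (simp_all add: assms del: upt_Suc)
qed (auto simp: assms)

lemma subcontext_append:
  assumes "\<And>p. length (A p) = k" "\<And>p. length (R p) = l"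
  shows "subcontext A (\<lambda>p. A p @ R p)"
proof (rule subcontextI)
  show "map ((!) (A p @ R p)) [0..<k] = A p" for p
    by (rule nth_equalityI) (simp_all add: assms nth_append)
qed (auto simp: assms)

lemma subcontext_Cons_Cons:
  assumes "subcontext B A"
  shows "subcontext (\<lambda>(y, p). x y # B p) (\<lambda>(y, p). x y # A p)"
proof -
  obtain k q where "distinct q" "set q \<subseteq> {..<k}" "\<And>p. length (A p) = k"
      "\<And>p. map ((!) (A p)) q = B p"
    using assms unfolding subcontext_def by blast
  then show ?thesis
    by (intro subcontextI[of "0 # map Suc q" "Suc k"]) (auto simp: distinct_map comp_def)
qed

lemma subcontext_move_front:
  assumes "\<And>p. length (L p) = i" "\<And>p. length (R p) = j"
  shows "subcontext (\<lambda>p. x p # L p @ R p) (\<lambda>p. L p @ x p # R p)"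
    and "subcontext (\<lambda>p. L p @ x p # R p) (\<lambda>p. x p # L p @ R p)"
proof -
  show "subcontext (\<lambda>p. x p # L p @ R p) (\<lambda>p. L p @ x p # R p)"
  proof (rule subcontextI)
    show "map ((!) (L p @ x p # R p)) (i # [0..<i] @ [Suc i..<Suc (i + j)]) = x p # L p @ R p" for p
      by (rule nth_equalityI)
        (auto simp: assms nth_append nth_Cons' simp del: upt_Suc)
  qed (auto simp: assms)
  show "subcontext (\<lambda>p. L p @ x p # R p) (\<lambda>p. x p # L p @ R p)"
  proof (rule subcontextI)
    show "map ((!) (x p # L p @ R p)) ([1..<Suc i] @ 0 # [Suc i..<Suc (i + j)]) =
        L p @ x p # R p" for p
      by (rule nth_equalityI)
        (auto simp: assms nth_append nth_Cons' simp del: upt_Suc)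
  qed (auto simp: assms)
qed

lemma computable_const:
  "(\<And>p. length (A p) = k) \<Longrightarrow> computable A (\<lambda>p. q)"
  by (rule partially_computableI) (auto intro: S2)

lemma computable1_id: "computable1 (\<lambda>n. n)"
  by (rule partially_computableI[where e = "list_encode [3]"])
    (auto intro: S3 simp del: list_encode.simps)

lemma computable1_Suc: "computable1 Suc"
  by (rule partially_computableI[where e = "list_encode [1]"])
    (auto intro: S1[unfolded One_nat_def] simp del: list_encode.simps)

lemma computable_Num:
  assumes "\<And>p. length (A p) = k" "i < k" "\<And>p. A p ! i = Low (Num (f p))"
  shows "computable A f"
proof (rule partially_computable_subcontext)
  show "computable (\<lambda>p. [Low (Num (f p))]) f"
    using computable1_id by (rule partially_computable_reparam)
  show "subcontext (\<lambda>p. [Low (Num (f p))]) A"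
    using assms by (intro subcontextI[of "[i]" k]) auto
qed

lemma partially_computable_bind:
  assumes "partially_computable A g"
    and "partially_computable (\<lambda>(n, p). Low (Num n) # A p) (\<lambda>(n, p). f n p)"
  shows "partially_computable A (\<lambda>p. Option.bind (g p) (\<lambda>n. f n p))"
proof -
  obtain k e2 where len: "\<And>p. length (A p) = k" and e2: "\<And>p m. g p = Some m \<Longrightarrow> kleene e2 (A p) m"
    using assms(1) unfolding partially_computable_def by blast
  obtain l e1 where "\<And>np m. (case np of (n, p) \<Rightarrow> f n p) = Some m \<Longrightarrow>
      kleene e1 (case np of (n, p) \<Rightarrow> Low (Num n) # A p) m"
    using assms(2) unfolding partially_computable_def by blast
  then have e1: "kleene e1 (Low (Num n) # A p) m" if "f n p = Some m" for n p m
    using that by fastforce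
  show ?thesis
    by (rule partially_computableI[OF len]) (auto simp: bind_eq_Some_conv intro: S4 e1 e2)
qed

lemma computable_let:
  assumes "computable A g" "computable (\<lambda>(n, p). Low (Num n) # A p) (\<lambda>(n, p). f n p)"
  shows "computable A (\<lambda>p. f (g p) p)"
  using partially_computable_bind[of A "\<lambda>p. Some (g p)" "\<lambda>n p. Some (f n p)"] assms
  by (simp add: case_prod_unfold)

lemma partially_computable_map_option:
  assumes "computable1 g" "partially_computable A a"
  shows "partially_computable A (\<lambda>p. map_option g (a p))"
proof -
  obtain k where len: "\<And>p. length (A p) = k"
    using assms(2) unfolding partially_computable_def by blast
  have "computable (\<lambda>(n, p). Low (Num n) # A p) (\<lambda>(n, p). g n)"
    using partially_computable_subcontext[OF partially_computable_reparam[OF assms(1), of fst]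
        subcontext_append[of _ 1 "\<lambda>(n, p). A p" k]] len
    by (simp add: case_prod_unfold)
  then have "partially_computable A (\<lambda>p. Option.bind (a p) (\<lambda>n. Some (g n)))"
    using partially_computable_bind[OF assms(2)] by (simp add: case_prod_unfold)
  then show ?thesis by (simp add: map_conv_bind_option comp_def)
qed

lemma computable_comp1:
  assumes "computable1 g" "computable A a"
  shows "computable A (\<lambda>p. g (a p))"
  using partially_computable_map_option[OF assms] by simp

lemma computable_comp2:
  assumes "computable2 g" "computable A a" "computable A b"
  shows "computable A (\<lambda>p. g (a p) (b p))"
proof -
  obtain k where len: "\<And>p. length (A p) = k"
    using assms(2) unfolding partially_computable_def by blast
  let ?A = "\<lambda>(n, p). Low (Num n) # A p"
  have "computable (\<lambda>(m, n, p). Low (Num m) # Low (Num n) # A p) (\<lambda>(m, n, p). g m n)"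
    using partially_computable_subcontext[OF
        partially_computable_reparam[OF assms(1), of "\<lambda>(m, n, p). (m, n)"]
        subcontext_append[of _ 2 "\<lambda>(m, n, p). A p" k]] len
    by (simp add: case_prod_unfold)
  then have "computable (\<lambda>(m, np). Low (Num m) # ?A np) (\<lambda>(m, np). g m (fst np))"
    by (simp add: case_prod_unfold)
  moreover have "computable ?A (\<lambda>(n, p). a p)"
    using partially_computable_subcontext[OF partially_computable_reparam[OF assms(2), of snd]
        subcontext_Cons[of _ k "\<lambda>(n, p). Low (Num n)"]] len
    by (simp add: case_prod_unfold)
  ultimately have "computable ?A (\<lambda>(n, p). g (a p) n)"
    using computable_let[of ?A "\<lambda>(n, p). a p" "\<lambda>m np. g m (fst np)"] by (simp add: case_prod_unfold)
  with assms(3) show ?thesis by (rule computable_let)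
qed

lemma computable_primrec:
  assumes "computable A (\<lambda>p. g 0 p)"
    and "computable (\<lambda>(n, k, p). Low (Num n) # Low (Num k) # A p) (\<lambda>(n, k, p). s n k p)"
    and "\<And>n p. g (Suc n) p = s n (g n p) p"
  shows "computable (\<lambda>(n, p). Low (Num n) # A p) (\<lambda>(n, p). g n p)"
proof -
  obtain k e1 where len: "\<And>p. length (A p) = k" and e1: "\<And>p. kleene e1 (A p) (g 0 p)"
    using assms(1) unfolding partially_computable_def by blast
  obtain l e2 where "\<And>nkp. kleene e2 (case nkp of (n, k, p) \<Rightarrow> Low (Num n) # Low (Num k) # A p)
      (case nkp of (n, k, p) \<Rightarrow> s n k p)"
    using assms(2) unfolding partially_computable_def by blast
  then have e2: "kleene e2 (Low (Num n) # Low (Num k) # A p) (s n k p)" for n k p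
    by (metis case_prod_conv)
  have "kleene (list_encode [5, e1, e2]) (Low (Num n) # A p) (g n p)" for n p
  proof (induction n)
    case 0
    show ?case using e1 by (rule S5_0)
  next
    case (Suc n)
    then show ?case unfolding assms(3) using e2 by (rule S5_Suc)
  qed
  then show ?thesis using len by (intro partially_computableI) auto
qed

lemma computable1_primrec:
  assumes "computable2 s" "\<And>n. g (Suc n) = s n (g n)"
  shows "computable1 g"
proof -
  have "computable (\<lambda>(n, k, p::unit). [Low (Num n), Low (Num k)]) (\<lambda>(n, k, p). s n k)"
    using partially_computable_reparam[OF assms(1), of "\<lambda>(n, k, p). (n, k)"]
    by (simp add: case_prod_unfold)
  then have "computable (\<lambda>(n, p::unit). [Low (Num n)]) (\<lambda>(n, p). g n)"
    using assms(2) by (intro computable_primrec[where A = "\<lambda>_. []"] computable_const) auto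
  from partially_computable_reparam[OF this, of "\<lambda>n. (n, ())"] show ?thesis by simp
qed

lemma computable_Fun:
  assumes "\<And>p. length (A p) = k" "i < k" "\<And>p. A p ! i = Low (Fun (f p))"
  shows "computable (\<lambda>(n, p). Low (Num n) # A p) (\<lambda>(n, p). f p n)"
proof (rule partially_computable_subcontext)
  show "computable (\<lambda>(n, p). [Low (Fun (f p)), Low (Num n)]) (\<lambda>(n, p). f p n)"
    by (rule partially_computableI[where e = "list_encode [7]"])
      (auto intro: S7 simp del: list_encode.simps)
  show "subcontext (\<lambda>(n, p). [Low (Fun (f p)), Low (Num n)]) (\<lambda>(n, p). Low (Num n) # A p)"
    using assms by (intro subcontextI[of "[Suc i, 0]" "Suc k"]) auto
qed

text \<open>
  This is stronger than \<open>\<exists>d. \<forall>p. denotes d (A p) (x p)\<close>: the type of \<open>x p\<close> must not vary with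
  \<open>p\<close>, because the index for a rearranged context depends on that type.
\<close>

inductive denotable :: "('p \<Rightarrow> obj list) \<Rightarrow> ('p \<Rightarrow> low) \<Rightarrow> bool" for A where
  denotable_Num: "computable A f \<Longrightarrow> denotable A (\<lambda>p. Num (f p))"
| denotable_Fun: "computable (\<lambda>(n, p). Low (Num n) # A p) (\<lambda>(n, p). f p n) \<Longrightarrow>
    denotable A (\<lambda>p. Fun (f p))"
| denotable_Fnl: "computable (\<lambda>(\<alpha>, p). Low (Fun \<alpha>) # A p) (\<lambda>(\<alpha>, p). F p \<alpha>) \<Longrightarrow>
    denotable A (\<lambda>p. Fnl (F p))"
| denotable_Op: "computable (\<lambda>(\<alpha>, n, p). Low (Fun \<alpha>) # Low (Num n) # A p) (\<lambda>(\<alpha>, n, p). F p \<alpha> n) \<Longrightarrow>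
    denotable A (\<lambda>p. Op (F p))"

lemma denotable_imp_denotes:
  assumes "denotable A x"
  shows "\<exists>d. \<forall>p. denotes d (A p) (x p)"
  using assms
proof cases
  case (denotable_Num f)
  then show ?thesis by (auto simp: partially_computable_def intro: den0)
next
  case (denotable_Fun f)
  then show ?thesis by (auto simp: partially_computable_def intro!: den1)
next
  case (denotable_Fnl F)
  then show ?thesis by (auto simp: partially_computable_def intro!: den2)
next
  case (denotable_Op F)
  then show ?thesis by (auto simp: partially_computable_def intro!: den11)
qed

lemma denotable_subcontext:
  assumes "denotable B x" "subcontext B A"
  shows "denotable A x"
  using assms(1)
proof cases
  case (denotable_Num f)
  from denotable_Num(2) assms(2) have "computable A f" by (rule partially_computable_subcontext)
  then show ?thesis unfolding denotable_Num(1) by (rule denotable.denotable_Num)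
next
  case (denotable_Fun f)
  show ?thesis unfolding denotable_Fun(1)
    using partially_computable_subcontext[OF denotable_Fun(2) subcontext_Cons_Cons[OF assms(2)]]
    by (rule denotable.denotable_Fun)
next
  case (denotable_Fnl F)
  show ?thesis unfolding denotable_Fnl(1)
    using partially_computable_subcontext[OF denotable_Fnl(2) subcontext_Cons_Cons[OF assms(2)]]
    by (rule denotable.denotable_Fnl)
next
  case (denotable_Op F)
  have "subcontext (\<lambda>(\<alpha>, n, p). Low (Fun \<alpha>) # Low (Num n) # B p)
      (\<lambda>(\<alpha>, n, p). Low (Fun \<alpha>) # Low (Num n) # A p)"
    using subcontext_Cons_Cons[OF subcontext_Cons_Cons[OF assms(2)]] by (simp add: case_prod_unfold)
  from partially_computable_subcontext[OF denotable_Op(2) this]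
  show ?thesis unfolding denotable_Op(1) by (rule denotable.denotable_Op)
qed

lemma denotable_list_imp_denotes:
  assumes "\<forall>x \<in> set xs. denotable A x"
  shows "\<exists>ds. \<forall>p. list_all2 (\<lambda>d x. denotes d (A p) x) ds (map (\<lambda>x. x p) xs)"
  using assms
proof (induction xs)
  case Nil
  show ?case by auto
next
  case (Cons x xs)
  then obtain ds where "\<And>p. list_all2 (\<lambda>d x. denotes d (A p) x) ds (map (\<lambda>x. x p) xs)" by auto
  moreover obtain d where "\<And>p. denotes d (A p) (x p)"
    using Cons.prems denotable_imp_denotes[of A x] by auto
  ultimately show ?case by (intro exI[of _ "d # ds"]) simp
qed

lemma partially_computable_obj_app:
  assumes "\<And>p. length (A p) = k" "i < k" "\<And>p. A p ! i = \<Phi> p" "\<forall>x \<in> set xs. denotable A x"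
  shows "partially_computable A (\<lambda>p. obj_app (\<Phi> p) (map (\<lambda>x. x p) xs))"
proof -
  let ?L = "\<lambda>p. take i (A p)" and ?R = "\<lambda>p. drop (Suc i) (A p)"
  let ?B = "\<lambda>p. \<Phi> p # ?L p @ ?R p"
  have decomposed: "A = (\<lambda>p. ?L p @ \<Phi> p # ?R p)"
    using id_take_nth_drop assms(1-3) by (metis (no_types))
  have "length (?L p) = i" "length (?R p) = k - Suc i" for p using assms(1,2) by simp_all
  note rearranged = subcontext_move_front[of ?L i ?R, OF this, of \<Phi>, folded decomposed]
  have "\<forall>x \<in> set xs. denotable ?B x" using assms(4) rearranged(2) denotable_subcontext by blast
  then obtain ds where "\<And>p. list_all2 (\<lambda>d x. denotes d (?B p) x) ds (map (\<lambda>x. x p) xs)"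
    using denotable_list_imp_denotes by blast
  then have "partially_computable ?B (\<lambda>p. obj_app (\<Phi> p) (map (\<lambda>x. x p) xs))"
    using assms(1) by (intro partially_computableI) (auto intro: S8)
  then show ?thesis using rearranged(1) by (rule partially_computable_subcontext)
qed

lemma computable_Fnl_termwise:
  assumes "computable1 c" "\<And>p. length (A p) = k"
    and "i < k" "\<And>p. A p ! i = Low (Fnl (F p))" "j < k" "\<And>p. A p ! j = Low (Fun (\<alpha> p))"
  shows "computable A (\<lambda>p. F p (\<lambda>n. c (\<alpha> p n)))"
proof -
  have "computable (\<lambda>(n, p). Low (Num n) # A p) (\<lambda>(n, p). c (\<alpha> p n))"
    using computable_comp1[OF assms(1) computable_Fun[of A k j \<alpha>, OF assms(2,5,6)]]
    by (simp add: case_prod_unfold)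
  then have "denotable A (\<lambda>p. Fun (\<lambda>n. c (\<alpha> p n)))" by (rule denotable_Fun)
  with partially_computable_obj_app[OF assms(2-4), of "[\<lambda>p. Fun (\<lambda>n. c (\<alpha> p n))]"]
  show ?thesis by simp
qed

lemma denotable_Fnl_argument:
  assumes "\<And>p. length (A p) = k" "i < k" "\<And>p. A p ! i = Low (Fnl (F p))"
  shows "denotable A (\<lambda>p. Fnl (F p))"
proof (rule denotable_Fnl)
  show "computable (\<lambda>(\<alpha>, p). Low (Fun \<alpha>) # A p) (\<lambda>(\<alpha>, p). F p \<alpha>)"
    using computable_Fnl_termwise[OF computable1_id, of "\<lambda>(\<alpha>, p). Low (Fun \<alpha>) # A p" "Suc k"
        "Suc i" "\<lambda>(\<alpha>, p). F p" 0 fst] assms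
    by (simp add: case_prod_unfold)
qed

lemma partially_computable_imp_kleene_computable_from:
  assumes "partially_computable (\<lambda>p. map Low (xs p) @ oracles) f"
  obtains C where "kleene_computable_from \<sigma> C oracles" "\<And>p m. f p = Some m \<Longrightarrow> C (xs p) = Some m"
proof -
  obtain k e where e: "\<And>p m. f p = Some m \<Longrightarrow> kleene e (map Low (xs p) @ oracles) m"
    using assms unfolding partially_computable_def by blast
  define C where "C ys = (if \<exists>m. kleene e (map Low ys @ oracles) m
      then Some (THE m. kleene e (map Low ys @ oracles) m) else None)" for ys
  have kleene_iff: "kleene e (map Low ys @ oracles) m \<longleftrightarrow> C ys = Some m" for ys m
  proof
    assume m: "kleene e (map Low ys @ oracles) m"
    then have "(THE m. kleene e (map Low ys @ oracles) m) = m"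
      using kleene_deterministic(1) by blast
    with m show "C ys = Some m" unfolding C_def by auto
  next
    assume "C ys = Some m"
    then show "kleene e (map Low ys @ oracles) m"
      unfolding C_def using kleene_deterministic(1) theI'[of "kleene e (map Low ys @ oracles)"]
      by (metis option.distinct(1) option.inject)
  qed
  then have "kleene_computable_from \<sigma> C oracles"
    unfolding kleene_computable_from_def by blast
  moreover have "C (xs p) = Some m" if "f p = Some m" for p m
    using e[OF that] kleene_iff by blast
  ultimately show thesis by (rule that)
qed

section \<open>Arithmetic on codes\<close>

abbreviation computable3 :: "(nat \<Rightarrow> nat \<Rightarrow> nat \<Rightarrow> nat) \<Rightarrow> bool" where
  "computable3 s \<equiv>
     computable (\<lambda>(n, k, y). [Low (Num n), Low (Num k), Low (Num y)]) (\<lambda>(n, k, y). s n k y)"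

lemma computable2_primrec:
  assumes "computable1 (g 0)" "computable3 s" "\<And>n y. g (Suc n) y = s n (g n y) y"
  shows "computable2 g"
  using computable_primrec[where A = "\<lambda>y. [Low (Num y)]", OF assms] .

lemma computable3_snd_comp:
  assumes "computable1 g"
  shows "computable3 (\<lambda>n k y. g k)"
proof -
  have "computable3 (\<lambda>n k y. k)" by (rule computable_Num[where k = 3 and i = 1]) auto
  from computable_comp1[OF assms this] show ?thesis by (simp add: case_prod_unfold)
qed

lemma computable3_thd_comp:
  assumes "computable1 g"
  shows "computable3 (\<lambda>n k y. g y)"
proof -
  have "computable3 (\<lambda>n k y. y)" by (rule computable_Num[where k = 3 and i = 2]) auto
  from computable_comp1[OF assms this] show ?thesis by (simp add: case_prod_unfold)
qed

lemma computable2_fst: "computable2 (\<lambda>m n. m)"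
  by (rule computable_Num[where k = 2 and i = 0]) auto

lemma computable2_snd: "computable2 (\<lambda>m n. n)"
  by (rule computable_Num[where k = 2 and i = 1]) auto

lemma computable2_const: "computable2 (\<lambda>m n. q)"
  by (simp add: case_prod_unfold computable_const)

lemma computable2_comp1:
  assumes "computable1 g" "computable2 a"
  shows "computable2 (\<lambda>m n. g (a m n))"
  using computable_comp1[OF assms] by (simp add: case_prod_unfold)

lemma computable2_comp2:
  assumes "computable2 g" "computable2 a" "computable2 b"
  shows "computable2 (\<lambda>m n. g (a m n) (b m n))"
  using computable_comp2[OF assms] by (simp add: case_prod_unfold)

lemma computable2_add: "computable2 (+)"
  by (rule computable2_primrec[OF _ computable3_snd_comp[OF computable1_Suc]])
    (simp_all add: computable1_id)

lemma computable1_pred: "computable1 (\<lambda>n. n - 1)"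
  by (rule computable1_primrec[OF computable2_fst]) simp

lemma computable2_diff: "computable2 (-)"
proof -
  have "computable2 (\<lambda>n y. y - n)"
    by (rule computable2_primrec[OF _ computable3_snd_comp[OF computable1_pred]])
      (simp_all add: computable1_id)
  from computable2_comp2[OF this computable2_snd computable2_fst] show ?thesis .
qed

lemma computable1_triangle: "computable1 triangle"
proof (rule computable1_primrec)
  show "computable2 (\<lambda>n k. k + Suc n)"
    by (intro computable2_comp2[OF computable2_add] computable2_comp1[OF computable1_Suc]
        computable2_fst computable2_snd)
qed simp

lemma computable1_power2: "computable1 (\<lambda>n. 2 ^ n)"
proof (rule computable1_primrec)
  show "computable2 (\<lambda>n k. k + k)"
    by (intro computable2_comp2[OF computable2_add] computable2_snd)
qed simp

lemma computable1_Suc_div_2: "computable1 (\<lambda>n. Suc n div 2)"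
proof (rule computable1_primrec)
  show "computable2 (\<lambda>n k. Suc n - k)"
    by (intro computable2_comp2[OF computable2_diff] computable2_comp1[OF computable1_Suc]
        computable2_fst computable2_snd)
qed presburger

lemma computable2_prod_encode: "computable2 (\<lambda>a b. prod_encode (a, b))"
  unfolding prod_encode_def prod.case
  by (intro computable2_comp2[OF computable2_add] computable2_comp1[OF computable1_triangle]
      computable2_fst computable2_snd)

lemma prod_decode_Suc:
  "prod_decode (Suc m) =
     (case prod_decode m of (a, 0) \<Rightarrow> (0, Suc a) | (a, Suc b) \<Rightarrow> (Suc a, b))"
proof -
  obtain a b where ab: "prod_decode m = (a, b)" by fastforce
  then have "m = prod_encode (a, b)" by (metis prod_decode_inverse)
  then have "Suc m = prod_encode (case b of 0 \<Rightarrow> (0, Suc a) | Suc b \<Rightarrow> (Suc a, b))"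
    by (simp add: prod_encode_def split: nat.split)
  then show ?thesis by (simp add: ab)
qed

definition prod_decode_sum :: "nat \<Rightarrow> nat" where
  "prod_decode_sum m = fst (prod_decode m) + snd (prod_decode m)"

lemma triangle_prod_decode_sum: "triangle (prod_decode_sum m) + fst (prod_decode m) = m"
  using prod_decode_inverse[of m]
  by (simp add: prod_decode_sum_def prod_encode_def case_prod_unfold)

text \<open>
  The truncated difference \<open>1 - (triangle (Suc s) - Suc m)\<close> is \<open>1\<close> if \<open>Suc m\<close> starts a new
  diagonal of the pairing, and \<open>0\<close> otherwise.
\<close>

lemma prod_decode_sum_Suc:
  "prod_decode_sum (Suc m) =
     prod_decode_sum m + (1 - (triangle (Suc (prod_decode_sum m)) - Suc m))"
  using triangle_prod_decode_sum[of m]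
  by (auto simp: prod_decode_sum_def prod_decode_Suc split: prod.splits nat.splits)

lemma computable1_prod_decode_sum: "computable1 prod_decode_sum"
proof (rule computable1_primrec)
  show "computable2 (\<lambda>m s. s + (1 - (triangle (Suc s) - Suc m)))"
    by (intro computable2_comp2[OF computable2_add] computable2_comp2[OF computable2_diff]
       computable2_comp1[OF computable1_Suc] computable2_comp1[OF computable1_triangle]
       computable2_fst computable2_snd computable2_const)
qed (rule prod_decode_sum_Suc)

lemma computable1_fst_prod_decode: "computable1 (\<lambda>m. fst (prod_decode m))"
proof -
  have "fst (prod_decode m) = m - triangle (prod_decode_sum m)" for m
    using triangle_prod_decode_sum[of m] by simp
  then show ?thesis
    using computable_comp2[OF computable2_diff computable1_id
        computable_comp1[OF computable1_triangle computable1_prod_decode_sum]] by simp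
qed

lemma computable1_snd_prod_decode: "computable1 (\<lambda>m. snd (prod_decode m))"
  using computable_comp2[OF computable2_diff computable1_prod_decode_sum
      computable1_fst_prod_decode]
  by (simp add: prod_decode_sum_def)

section \<open>Codes of rationals and names of reals\<close>

lemma rat_code_eq:
  assumes "quotient_of q = (a, b)"
  shows "rat_code q = prod_encode (int_encode a, nat b)"
  by (simp add: rat_code_def assms)

lemma quotient_of_divide:
  assumes "b > 0" "coprime a b"
  shows "quotient_of (of_int a / of_int b) = (a, b)"
  using assms quotient_of_Fract[of a b]
  by (simp add: Fract_of_int_quotient Rat.normalize_def coprime_iff_gcd_eq_1)

lemma inj_rat_code: "inj rat_code"
proof (rule injI)
  fix p q assume "rat_code p = rat_code q"
  then have "fst (quotient_of p) = fst (quotient_of q)"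
    and "nat (snd (quotient_of p)) = nat (snd (quotient_of q))"
    by (auto simp: rat_code_def int_encode_eq)
  moreover have "snd (quotient_of p) > 0" "snd (quotient_of q) > 0"
    by (rule quotient_of_denom_pos')+
  ultimately have "quotient_of p = quotient_of q" by (simp add: prod_eq_iff)
  then show "p = q" by (simp add: quotient_of_inject)
qed

lemma int_encode_of_nat: "int_encode (int n) = 2 * n"
  by (simp add: int_encode_def sum_encode_def)

lemma rat_code_inverse_power2: "rat_code (1 / 2 ^ k) = prod_encode (2, 2 ^ k)"
  using quotient_of_divide[of "2 ^ k" 1] int_encode_of_nat[of 1]
  by (simp add: rat_code_def nat_power_eq)

definition weight_code :: "nat \<Rightarrow> nat \<Rightarrow> nat" where
  "weight_code a k = rat_code (if a = 0 then 0 else 1 / 2 ^ k)"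

lemma computable2_weight_code: "computable2 weight_code"
proof (rule computable2_primrec)
  show "computable1 (weight_code 0)"
    by (simp add: weight_code_def computable_const)
  show "computable3 (\<lambda>n k y. prod_encode (2, 2 ^ y))"
    using computable_comp2[OF computable2_prod_encode computable_const[of _ 1 2] computable1_power2]
    by (intro computable3_thd_comp) simp
qed (simp add: weight_code_def rat_code_inverse_power2)

text \<open>
  The map \<open>x \<mapsto> \<bar>x\<bar> / (1 + \<bar>x\<bar>)\<close> is 1-Lipschitz and sends the reduced fraction \<open>a/b\<close> to the
  reduced fraction \<open>\<bar>a\<bar>/(b + \<bar>a\<bar>)\<close>, so it acts on names of reals termwise and without cancellation.
\<close>

definition squash :: "'a :: linordered_field \<Rightarrow> 'a" where
  "squash x = \<bar>x\<bar> / (1 + \<bar>x\<bar>)"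

lemma Suc_int_encode_div_2: "Suc (int_encode a) div 2 = nat \<bar>a\<bar>"
  by (cases "a \<ge> 0") (auto simp: int_encode_def sum_encode_def nat_diff_distrib')

definition squash_code :: "nat \<Rightarrow> nat" where
  "squash_code m = (case prod_decode m of (c, b) \<Rightarrow>
     let h = Suc c div 2 in prod_encode (2 * h, b + h))"

lemma computable1_squash_code: "computable1 squash_code"
  unfolding squash_code_def Let_def mult_2 case_prod_unfold
  by (intro computable_comp2[OF computable2_prod_encode] computable_comp2[OF computable2_add]
      computable_comp1[OF computable1_Suc_div_2] computable1_fst_prod_decode
      computable1_snd_prod_decode)

lemma quotient_of_squash:
  assumes "quotient_of q = (a, b)"
  shows "quotient_of (squash q) = (\<bar>a\<bar>, b + \<bar>a\<bar>)"
proof -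
  have b_pos: "b > 0" and "coprime a b"
    using assms by (auto intro: quotient_of_denom_pos quotient_of_coprime)
  then have "coprime \<bar>a\<bar> (b + \<bar>a\<bar>)"
    using gcd_add1[of b "\<bar>a\<bar>"] by (simp add: coprime_iff_gcd_eq_1 gcd.commute)
  moreover have "squash q = of_int \<bar>a\<bar> / of_int (b + \<bar>a\<bar>)"
    using b_pos by (simp add: squash_def quotient_of_div[OF assms] field_simps)
  ultimately show ?thesis using b_pos quotient_of_divide[of "b + \<bar>a\<bar>" "\<bar>a\<bar>"] by simp
qed

lemma squash_code_rat_code: "squash_code (rat_code q) = rat_code (squash q)"
proof -
  obtain a b where ab: "quotient_of q = (a, b)" by fastforce
  then have "b > 0" by (rule quotient_of_denom_pos)
  then show ?thesis
    using int_encode_of_nat[of "nat \<bar>a\<bar>"]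
    by (simp add: squash_code_def rat_code_eq[OF ab] rat_code_eq[OF quotient_of_squash[OF ab]]
        Let_def Suc_int_encode_div_2 nat_add_distrib)
qed

lemma squash_Lipschitz: "\<bar>squash x - squash y\<bar> \<le> \<bar>x - y :: 'a :: linordered_field\<bar>"
proof -
  have pos: "1 + \<bar>x\<bar> > 0" "1 + \<bar>y\<bar> > 0" by (simp_all add: add_pos_nonneg)
  then have "squash x - squash y = (\<bar>x\<bar> - \<bar>y\<bar>) / ((1 + \<bar>x\<bar>) * (1 + \<bar>y\<bar>))"
    by (simp add: squash_def field_simps)
  moreover have "1 * 1 \<le> (1 + \<bar>x\<bar>) * (1 + \<bar>y\<bar>)" by (rule mult_mono) auto
  ultimately have "\<bar>squash x - squash y\<bar> \<le> \<bar>\<bar>x\<bar> - \<bar>y\<bar>\<bar>"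
    using pos by (simp add: abs_mult divide_le_eq mult_le_cancel_left1)
  also have "\<dots> \<le> \<bar>x - y\<bar>" by (rule abs_triangle_ineq3)
  finally show ?thesis .
qed

lemma inj_on_squash: "inj_on squash {0 :: real..}"
  by (rule inj_onI) (simp add: squash_def field_simps)

lemma squash_in_unit_interval: "squash (x :: real) \<in> {0..1}"
  by (simp add: squash_def)

lemma represents_real_squash: "represents_real UNIV (\<lambda>\<alpha> n. squash_code (\<alpha> n)) squash"
  unfolding represents_real_def
proof (intro allI impI)
  fix \<alpha> x assume "names \<alpha> x \<and> x \<in> UNIV"
  then obtain q :: "nat \<Rightarrow> rat" where q: "\<And>n. \<alpha> n = rat_code (q n)"
    "\<And>n i. \<bar>q n - q (n + i)\<bar> < 1 / 2 ^ n" "(\<lambda>n. real_of_rat (q n)) \<longlonglongrightarrow> x"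
    unfolding names_def by blast
  have "(\<lambda>n. squash (real_of_rat (q n))) \<longlonglongrightarrow> squash x"
    unfolding squash_def by (intro tendsto_intros q) auto
  moreover have "squash (real_of_rat r) = real_of_rat (squash r)" for r
    by (simp add: squash_def of_rat_divide of_rat_add)
  moreover have "\<bar>squash (q n) - squash (q (n + i))\<bar> < 1 / 2 ^ n" for n i
    using squash_Lipschitz q(2) by (rule le_less_trans)
  ultimately show "names (\<lambda>n. squash_code (\<alpha> n)) (squash x)"
    unfolding names_def by (intro exI[of _ "\<lambda>n. squash (q n)"]) (simp add: q squash_code_rat_code)
qed

lemma names_of_rat: "names (\<lambda>n. rat_code q) (real_of_rat q)"
  unfolding names_def by (rule exI[of _ "\<lambda>_. q"]) simp

lemma represents_rat_imp_represents_real: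
  "represents_rat D F f \<Longrightarrow> represents_real D (\<lambda>\<alpha> n. F \<alpha>) (\<lambda>x. real_of_rat (f x))"
  by (simp add: represents_rat_def represents_nat_def represents_real_def names_of_rat)

section \<open>Summable functions of a real variable\<close>

lemma sum_abs_le_infsum:
  fixes h :: "'a \<Rightarrow> real"
  assumes "h summable_on D" "finite I" "inj_on y I" "y ` I \<subseteq> D"
  shows "(\<Sum>i\<in>I. \<bar>h (y i)\<bar>) \<le> (\<Sum>\<^sub>\<infinity>x\<in>D. \<bar>h x\<bar>)"
proof -
  have "(\<Sum>i\<in>I. \<bar>h (y i)\<bar>) = (\<Sum>x\<in>y ` I. \<bar>h x\<bar>)" using assms(3) by (simp add: sum.reindex)
  also have "\<dots> \<le> (\<Sum>\<^sub>\<infinity>x\<in>D. \<bar>h x\<bar>)"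
    using assms summable_on_iff_abs_summable_on_real[THEN iffD1, OF assms(1)]
    by (intro finite_sum_le_infsum) auto
  finally show ?thesis .
qed

lemma strict_mono_on_increasing_points:
  assumes "increasing_points x n"
  shows "strict_mono_on {..n} x"
proof (rule strict_mono_onI)
  fix i j assume "i \<in> {..n}" "j \<in> {..n}" "i < j"
  from \<open>i < j\<close> \<open>j \<in> {..n}\<close> show "x i < x j"
  proof (induction j)
    case (Suc j)
    have "x j < x (Suc j)" using assms Suc.prems unfolding increasing_points_def by simp
    with Suc show ?case by (cases "i = j") auto
  qed simp
qed

lemma increasing_points_le:
  assumes "increasing_points x n" "i \<le> j" "j \<le> n"
  shows "x i \<le> x j"
  using strict_mono_on_leD[OF strict_mono_on_increasing_points[OF assms(1)]] assms(2,3) by simp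

lemma variation_sum_le_infsum:
  assumes summable: "h summable_on {a..b}" and points: "increasing_points x n" "a \<le> x 0" "x n \<le> b"
  shows "variation_sum h x n \<le> 2 * (\<Sum>\<^sub>\<infinity>x\<in>{a..b}. \<bar>h x\<bar>)"
proof -
  have in_interval: "x i \<in> {a..b}" if "i \<le> n" for i
    using increasing_points_le[OF points(1), of 0 i] increasing_points_le[OF points(1), of i n]
      points that by auto
  have inj: "inj_on x {..n}"
    using strict_mono_on_increasing_points[OF points(1)] by (rule strict_mono_on_imp_inj_on)
  have "variation_sum h x n \<le> (\<Sum>i<n. \<bar>h (x i)\<bar> + \<bar>h (x (Suc i))\<bar>)"
    unfolding variation_sum_def by (rule sum_mono) simp
  also have "\<dots> = (\<Sum>i<n. \<bar>h (x i)\<bar>) + (\<Sum>i<n. \<bar>h ((x \<circ> Suc) i)\<bar>)" by (simp add: sum.distrib)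
  also have "(\<Sum>i<n. \<bar>h (x i)\<bar>) \<le> (\<Sum>\<^sub>\<infinity>x\<in>{a..b}. \<bar>h x\<bar>)"
    using in_interval by (intro sum_abs_le_infsum[OF summable] inj_on_subset[OF inj]) auto
  also have "(\<Sum>i<n. \<bar>h ((x \<circ> Suc) i)\<bar>) \<le> (\<Sum>\<^sub>\<infinity>x\<in>{a..b}. \<bar>h x\<bar>)"
  proof (rule sum_abs_le_infsum[OF summable])
    show "inj_on (x \<circ> Suc) {..<n}" by (intro comp_inj_on inj_on_subset[OF inj]) auto
    show "(x \<circ> Suc) ` {..<n} \<subseteq> {a..b}" using in_interval by fastforce
  qed simp
  finally show ?thesis by simp
qed

lemma summable_on_imp_bounded_variation:
  assumes "h summable_on {a..b}"
  shows "bounded_variation a b h"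
proof -
  obtain k :: nat where "2 * (\<Sum>\<^sub>\<infinity>x\<in>{a..b}. \<bar>h x\<bar>) \<le> real k" using real_arch_simple by blast
  then have "variation_sum h x n \<le> real k" if "increasing_points x n" "x 0 = a" "x n = b" for x n
    using variation_sum_le_infsum[OF assms that(1)] that by fastforce
  then show ?thesis unfolding bounded_variation_def by blast
qed

lemma summable_on_imp_has_variation:
  assumes "h summable_on {a..b}" "a \<le> b"
  shows "has_variation a b h"
  unfolding has_variation_def
proof (rule reals_complete)
  let ?S = "{variation_sum h x n |x n. increasing_points x n \<and> a \<le> x 0 \<and> x n \<le> b}"
  have "variation_sum h (\<lambda>_. a) 0 \<in> ?S" using assms(2) by (force simp: increasing_points_def)
  then show "\<exists>X. X \<in> ?S" by blast
  show "\<exists>Y. isUb UNIV ?S Y"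
    using variation_sum_le_infsum[OF assms(1)] by (auto simp: isUb_def setle_def)
qed

text \<open>A point is the tag of at most two intervals, and these are adjacent.\<close>

lemma inj_on_tags_of_same_parity:
  assumes "increasing_points x n" "\<And>i. i < n \<Longrightarrow> x i \<le> t i" "\<And>i. i < n \<Longrightarrow> t i \<le> x (Suc i)"
  shows "inj_on t {i. i < n \<and> even i = c}"
proof (rule inj_onI, rule ccontr)
  fix i j assume ij: "i \<in> {i. i < n \<and> even i = c}" "j \<in> {i. i < n \<and> even i = c}" "t i = t j" "i \<noteq> j"
  have tag_less: "t i < t j" if "Suc i < j" "j < n" for i j
  proof -
    have "x (Suc i) < x j"
      using strict_mono_onD[OF strict_mono_on_increasing_points[OF assms(1)], of "Suc i" j] that
      by simp
    then show ?thesis using assms(2)[of j] assms(3)[of i] that by simp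
  qed
  have "j \<noteq> Suc i" "i \<noteq> Suc j" using ij by auto
  then have "Suc i < j \<or> Suc j < i" using ij(4) by linarith
  then show False using tag_less[of i j] tag_less[of j i] ij by auto
qed

lemma sum_abs_tags_le_infsum:
  fixes h :: "real \<Rightarrow> real"
  assumes summable: "h summable_on {a..b}" and points: "increasing_points x n" "x 0 = a" "x n = b"
    and tags: "\<And>i. i < n \<Longrightarrow> x i \<le> t i" "\<And>i. i < n \<Longrightarrow> t i \<le> x (Suc i)"
  shows "(\<Sum>i<n. \<bar>h (t i)\<bar>) \<le> 2 * (\<Sum>\<^sub>\<infinity>x\<in>{a..b}. \<bar>h x\<bar>)"
proof -
  let ?I = "\<lambda>c. {i. i < n \<and> even i = c}"
  have "t i \<in> {a..b}" if "i < n" for i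
    using increasing_points_le[OF points(1), of 0 i]
      increasing_points_le[OF points(1), of "Suc i" n] points
      tags(1)[OF that] tags(2)[OF that] that by auto
  then have parity: "(\<Sum>i\<in>?I c. \<bar>h (t i)\<bar>) \<le> (\<Sum>\<^sub>\<infinity>x\<in>{a..b}. \<bar>h x\<bar>)" for c
    by (intro sum_abs_le_infsum[OF summable] inj_on_tags_of_same_parity[OF points(1) tags]) auto
  have "{..<n} = ?I True \<union> ?I False" by auto
  then have "(\<Sum>i<n. \<bar>h (t i)\<bar>) = (\<Sum>i\<in>?I True. \<bar>h (t i)\<bar>) + (\<Sum>i\<in>?I False. \<bar>h (t i)\<bar>)"
    by (simp only:) (rule sum.union_disjoint, auto)
  also have "\<dots> \<le> 2 * (\<Sum>\<^sub>\<infinity>x\<in>{a..b}. \<bar>h x\<bar>)" using parity[of True] parity[of False] by simp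
  finally show ?thesis .
qed

lemma summable_on_imp_has_riemann_integral_0:
  assumes summable: "h summable_on {a..b}"
  shows "has_riemann_integral h a b 0"
  unfolding has_riemann_integral_def
proof (intro allI impI)
  fix \<epsilon> :: real assume "\<epsilon> > 0"
  let ?B = "\<Sum>\<^sub>\<infinity>x\<in>{a..b}. \<bar>h x\<bar>"
  define \<delta> where "\<delta> = \<epsilon> / (2 * ?B + 1)"
  have "0 \<le> ?B" by (rule infsum_nonneg) simp
  with \<open>\<epsilon> > 0\<close> have \<delta>: "\<delta> > 0" "\<delta> * (2 * ?B) < \<epsilon>" by (auto simp: \<delta>_def field_simps)
  have "\<bar>\<Sum>i<n. h (t i) * (x (Suc i) - x i)\<bar> < \<epsilon>"
    if points: "increasing_points x n" "x 0 = a" "x n = b"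
      and tags: "\<forall>i<n. x i \<le> t i \<and> t i \<le> x (Suc i) \<and> x (Suc i) - x i < \<delta>" for x t n
  proof -
    have "\<bar>h (t i) * (x (Suc i) - x i)\<bar> \<le> \<delta> * \<bar>h (t i)\<bar>" if "i < n" for i
    proof -
      have "\<bar>x (Suc i) - x i\<bar> \<le> \<delta>" using points(1) tags that unfolding increasing_points_def by auto
      from mult_left_mono[OF this, of "\<bar>h (t i)\<bar>"]
      show ?thesis by (simp add: abs_mult mult.commute)
    qed
    then have "\<bar>\<Sum>i<n. h (t i) * (x (Suc i) - x i)\<bar> \<le> (\<Sum>i<n. \<delta> * \<bar>h (t i)\<bar>)"
      by (intro order_trans[OF sum_abs] sum_mono) simp
    also have "\<dots> = \<delta> * (\<Sum>i<n. \<bar>h (t i)\<bar>)" by (simp add: sum_distrib_left)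
    also have "\<dots> \<le> \<delta> * (2 * ?B)"
      using sum_abs_tags_le_infsum[OF summable points] tags \<delta>(1) by (intro mult_left_mono) auto
    also have "\<dots> < \<epsilon>" by (rule \<delta>(2))
    finally show ?thesis .
  qed
  with \<delta>(1) show "\<exists>\<delta>>0. \<forall>x t n. increasing_points x n \<and> x 0 = a \<and> x n = b \<and>
      (\<forall>i<n. x i \<le> t i \<and> t i \<le> x (Suc i) \<and> x (Suc i) - x i < \<delta>) \<longrightarrow>
      \<bar>(\<Sum>i<n. h (t i) * (x (Suc i) - x i)) - 0\<bar> < \<epsilon>"
    by (intro exI[of _ \<delta>]) simp
qed

lemma summable_on_imp_riemann_integrable: "h summable_on {a..b} \<Longrightarrow> riemann_integrable a b h"
  unfolding riemann_integrable_def using summable_on_imp_has_riemann_integral_0 by blast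

lemma summable_on_imp_has_laplace_transform_0:
  assumes summable: "h summable_on {0..}" and "s \<ge> 0"
  shows "has_laplace_transform h s 0"
proof -
  have "(\<lambda>t. exp (- s * t) * h t) summable_on {0..N}" for N
  proof -
    have "h summable_on {0..N}" using summable by (rule summable_on_subset_banach) simp
    then have "(\<lambda>t. norm (h t)) summable_on {0..N}"
      by (rule summable_on_iff_abs_summable_on_real[THEN iffD1])
    moreover have "norm (exp (- s * t) * h t) \<le> norm (h t)" if "t \<in> {0..N}" for t
      using that \<open>s \<ge> 0\<close> by (simp add: abs_mult mult_left_le_one_le)
    ultimately have "(\<lambda>t. norm (exp (- s * t) * h t)) summable_on {0..N}"
      by (rule Infinite_Sum.abs_summable_on_comparison_test)
    then show ?thesis by (rule summable_on_iff_abs_summable_on_real[THEN iffD2])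
  qed
  then have "\<forall>N>0. has_riemann_integral (\<lambda>t. exp (- s * t) * h t) 0 N 0"
    using summable_on_imp_has_riemann_integral_0 by blast
  then show ?thesis unfolding has_laplace_transform_def by (intro exI[of _ "\<lambda>_. 0"]) simp
qed

lemma summable_on_continuous_imp_eq_0:
  fixes h :: "real \<Rightarrow> real"
  assumes summable: "h summable_on {a..b}" and "a < b" "x \<in> {a..b}"
    and cont: "continuous (at x within {a..b}) h"
  shows "h x = 0"
proof (rule ccontr)
  assume "h x \<noteq> 0"
  then obtain d where d: "d > 0" "\<And>y. y \<in> {a..b} \<Longrightarrow> dist y x < d \<Longrightarrow> dist (h y) (h x) < \<bar>h x\<bar>"
    using cont unfolding continuous_within_eps_delta by (metis zero_less_abs_iff)
  define l u where "l = max a (x - d)" and "u = min b (x + d)"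
  have "l < u" using assms(2,3) d(1) by (auto simp: l_def u_def)
  moreover have "{l<..<u} \<subseteq> {y \<in> {a..b}. h y \<noteq> 0}"
  proof
    fix y assume "y \<in> {l<..<u}"
    then have y: "y \<in> {a..b}" "dist y x < d" by (auto simp: l_def u_def dist_real_def)
    have "h y \<noteq> 0" using d(2)[OF y] by (auto simp: dist_real_def)
    with y(1) show "y \<in> {y \<in> {a..b}. h y \<noteq> 0}" by simp
  qed
  moreover have "countable {y \<in> {a..b}. h y \<noteq> 0}" using summable by (rule summable_countable_real)
  ultimately show False using uncountable_open_interval countable_subset by blast
qed

definition includes_summable :: "(real \<Rightarrow> real \<Rightarrow> (real \<Rightarrow> real) \<Rightarrow> bool) \<Rightarrow> bool" where
  "includes_summable V \<longleftrightarrow> (\<forall>a b h. a < b \<and> h summable_on {a..b} \<longrightarrow> V a b h)"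

lemma includes_summableD: "\<lbrakk>includes_summable V; a < b; h summable_on {a..b}\<rbrakk> \<Longrightarrow> V a b h"
  unfolding includes_summable_def by blast

lemma includes_summable_bounded_variation: "includes_summable bounded_variation"
  by (simp add: includes_summable_def summable_on_imp_bounded_variation)

lemma includes_summable_has_variation: "includes_summable has_variation"
  by (simp add: includes_summable_def summable_on_imp_has_variation)

lemma includes_summable_riemann_integrable: "includes_summable riemann_integrable"
  by (simp add: includes_summable_def summable_on_imp_riemann_integrable)

section \<open>The weight of a countable set\<close>

definition weight :: "real set \<Rightarrow> (real \<Rightarrow> nat) \<Rightarrow> real \<Rightarrow> rat" where
  "weight A Y x = (if x \<in> A then 1 / 2 ^ Y x else 0)"

lemma weight_eq_0_iff: "weight A Y x = 0 \<longleftrightarrow> x \<notin> A"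
  by (simp add: weight_def)

lemma of_rat_weight: "real_of_rat (weight A Y x) = (if x \<in> A then (1 / 2) ^ Y x else 0)"
  by (simp add: weight_def of_rat_divide of_rat_power power_one_over)

lemma weight_in_unit_interval: "real_of_rat (weight A Y x) \<in> {0..1}"
  by (simp add: of_rat_weight power_le_one)

lemma weight_eq_imp_notin:
  assumes "inj_on Y A" "weight A Y x = weight A Y y" "x \<noteq> y"
  shows "x \<notin> A"
proof
  assume x_in: "x \<in> A"
  then have y_in: "y \<in> A" using assms(2) weight_eq_0_iff by metis
  have "(2::rat) ^ Y x = 2 ^ Y y" using assms(2) x_in y_in by (simp add: weight_def)
  then have "Y x = Y y" by simp
  then show False using assms x_in y_in by (auto dest: inj_onD)
qed

lemma summable_on_weight:
  assumes "inj_on Y A"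
  shows "(\<lambda>x. real_of_rat (weight A Y x)) summable_on D"
proof -
  have "(\<lambda>n. (1 / 2 :: real) ^ n) summable_on UNIV"
    by (rule norm_summable_imp_summable_on) (simp add: summable_geometric)
  then have "(\<lambda>n. (1 / 2 :: real) ^ n) summable_on Y ` A" by (rule summable_on_subset_banach) simp
  then have "(\<lambda>x. (1 / 2 :: real) ^ Y x) summable_on A"
    using assms by (simp add: summable_on_reindex comp_def)
  then have "(\<lambda>x. real_of_rat (weight A Y x)) summable_on UNIV"
    by (rule summable_on_cong_neutral[THEN iffD1, rotated -1]) (auto simp: of_rat_weight)
  then show ?thesis by (rule summable_on_subset_banach) simp
qed

lemma summable_on_weight_squash:
  assumes "inj_on Y A"
  shows "(\<lambda>x. real_of_rat (weight A Y (squash x))) summable_on {0..}"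
  using summable_on_weight[OF assms, of "squash ` {0..}"]
  by (simp add: summable_on_reindex[OF inj_on_squash] comp_def)

section \<open>Cantor realisers from the tasks\<close>

definition weight_functional ::
  "(nat \<Rightarrow> nat) \<Rightarrow> ((nat \<Rightarrow> nat) \<Rightarrow> nat) \<Rightarrow> ((nat \<Rightarrow> nat) \<Rightarrow> nat) \<Rightarrow> (nat \<Rightarrow> nat) \<Rightarrow> nat" where
  "weight_functional c F\<^sub>A F\<^sub>Y \<alpha> = weight_code (F\<^sub>A (\<lambda>n. c (\<alpha> n))) (F\<^sub>Y (\<lambda>n. c (\<alpha> n)))"

lemma represents_rat_weight_functional:
  assumes "represents_real D (\<lambda>\<alpha> n. c (\<alpha> n)) g" "g ` D \<subseteq> {0..1}"
    and "represents_set {0..1} F\<^sub>A A" "represents_nat {0..1} F\<^sub>Y Y"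
  shows "represents_rat D (weight_functional c F\<^sub>A F\<^sub>Y) (\<lambda>x. weight A Y (g x))"
  unfolding represents_rat_def represents_nat_def
proof (intro allI impI)
  fix \<alpha> x assume "names \<alpha> x \<and> x \<in> D"
  then have "names (\<lambda>n. c (\<alpha> n)) (g x)" "g x \<in> {0..1}"
    using assms(1,2) unfolding represents_real_def by auto
  then have "F\<^sub>A (\<lambda>n. c (\<alpha> n)) = (if g x \<in> A then 1 else 0)" "F\<^sub>Y (\<lambda>n. c (\<alpha> n)) = Y (g x)"
    using assms(3,4) unfolding represents_set_def represents_nat_def by blast+
  then show "weight_functional c F\<^sub>A F\<^sub>Y \<alpha> = rat_code (weight A Y (g x))"
    by (simp add: weight_functional_def weight_code_def weight_def)
qed

lemma computable_weight_functional:
  assumes "computable1 c" "\<And>p. length (A p) = k"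
    and "i < k" "\<And>p. A p ! i = Low (Fnl (F p))" "j < k" "\<And>p. A p ! j = Low (Fnl (G p))"
    and "l < k" "\<And>p. A p ! l = Low (Fun (\<alpha> p))"
  shows "computable A (\<lambda>p. weight_functional c (F p) (G p) (\<alpha> p))"
  unfolding weight_functional_def
  by (rule computable_comp2[OF computable2_weight_code])
    (rule computable_Fnl_termwise[OF assms(1-4,7,8)],
      rule computable_Fnl_termwise[OF assms(1,2,5-8)])

lemma denotable_weight_functional:
  assumes "computable1 c" "\<And>p. length (A p) = k"
    and "i < k" "\<And>p. A p ! i = Low (Fnl (F p))" "j < k" "\<And>p. A p ! j = Low (Fnl (G p))"
  shows "denotable A (\<lambda>p. Fnl (weight_functional c (F p) (G p)))"
    and "denotable A (\<lambda>p. Op (\<lambda>\<alpha> n. weight_functional c (F p) (G p) \<alpha>))"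
proof -
  have "computable (\<lambda>(\<alpha>, p). Low (Fun \<alpha>) # A p)
      (\<lambda>(\<alpha>, p). weight_functional c (F p) (G p) \<alpha>)"
    using computable_weight_functional[OF assms(1), of "\<lambda>(\<alpha>, p). Low (Fun \<alpha>) # A p" "Suc k"
        "Suc i" "\<lambda>(\<alpha>, p). F p" "Suc j" "\<lambda>(\<alpha>, p). G p" 0 fst] assms
    by (simp add: case_prod_unfold)
  then show "denotable A (\<lambda>p. Fnl (weight_functional c (F p) (G p)))" by (rule denotable_Fnl)
  have "computable (\<lambda>(\<alpha>, n, p). Low (Fun \<alpha>) # Low (Num n) # A p)
      (\<lambda>(\<alpha>, n, p). weight_functional c (F p) (G p) \<alpha>)"
    using computable_weight_functional[OF assms(1),
        of "\<lambda>(\<alpha>, n, p). Low (Fun \<alpha>) # Low (Num n) # A p" "Suc (Suc k)"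
        "Suc (Suc i)" "\<lambda>(\<alpha>, n, p). F p" "Suc (Suc j)" "\<lambda>(\<alpha>, n, p). G p" 0 fst] assms
    by (simp add: case_prod_unfold)
  then show "denotable A (\<lambda>p. Op (\<lambda>\<alpha> n. weight_functional c (F p) (G p) \<alpha>))"
    by (rule denotable_Op)
qed

definition cantor_input :: "((nat \<Rightarrow> nat) \<Rightarrow> nat) \<times> ((nat \<Rightarrow> nat) \<Rightarrow> nat) \<times> nat \<Rightarrow> low list" where
  "cantor_input = (\<lambda>(F\<^sub>A, F\<^sub>Y, n). [Fnl F\<^sub>A, Fnl F\<^sub>Y, Num n])"

definition cantor_context ::
  "obj \<Rightarrow> ((nat \<Rightarrow> nat) \<Rightarrow> nat) \<times> ((nat \<Rightarrow> nat) \<Rightarrow> nat) \<times> nat \<Rightarrow> obj list" where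
  "cantor_context \<Phi> p = map Low (cantor_input p) @ [\<Phi>, Low (Fnl exists2)]"

lemma length_cantor_context: "length (cantor_context \<Phi> p) = 5"
  by (simp add: cantor_context_def cantor_input_def case_prod_unfold)

lemma cantor_context_nth:
  "cantor_context \<Phi> p ! 0 = Low (Fnl (fst p))"
  "cantor_context \<Phi> p ! 1 = Low (Fnl (fst (snd p)))"
  "cantor_context \<Phi> p ! 2 = Low (Num (snd (snd p)))"
  "cantor_context \<Phi> p ! 3 = \<Phi>"
  by (simp_all add: cantor_context_def cantor_input_def case_prod_unfold)

lemma denotable_weight_functional_cantor_context:
  assumes "computable1 c"
  shows "denotable (cantor_context \<Phi>) (\<lambda>(F\<^sub>A, F\<^sub>Y, n). Fnl (weight_functional c F\<^sub>A F\<^sub>Y))"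
    and "denotable (cantor_context \<Phi>) (\<lambda>(F\<^sub>A, F\<^sub>Y, n). Op (\<lambda>\<alpha> j. weight_functional c F\<^sub>A F\<^sub>Y \<alpha>))"
  using denotable_weight_functional[OF assms length_cantor_context _ cantor_context_nth(1) _
      cantor_context_nth(2)]
  by (simp_all add: case_prod_unfold)

lemma partially_computable_oracle_cantor_context:
  assumes "\<forall>x \<in> set xs. denotable (cantor_context (Fnl3 \<tau> T)) (\<lambda>(F\<^sub>A, F\<^sub>Y, n). x F\<^sub>A F\<^sub>Y)"
    and "\<And>F\<^sub>A F\<^sub>Y. map (\<lambda>x. ty_of (x F\<^sub>A F\<^sub>Y)) xs @ [Ty0] = \<tau>"
  shows "partially_computable (cantor_context (Fnl3 \<tau> T))
    (\<lambda>(F\<^sub>A, F\<^sub>Y, n). T (map (\<lambda>x. x F\<^sub>A F\<^sub>Y) xs @ [Num n]))"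
proof -
  let ?A = "cantor_context (Fnl3 \<tau> T)"
  let ?ys = "map (\<lambda>x (F\<^sub>A, F\<^sub>Y, n). x F\<^sub>A F\<^sub>Y) xs @ [\<lambda>(F\<^sub>A, F\<^sub>Y, n). Num n]"
  have "denotable ?A (\<lambda>p. Num (snd (snd p)))"
    by (intro denotable_Num computable_Num[OF length_cantor_context _ cantor_context_nth(3)]) simp
  with assms(1) have denotable_args: "\<forall>y \<in> set ?ys. denotable ?A y" by (simp add: case_prod_unfold)
  have "partially_computable ?A (\<lambda>p. obj_app (Fnl3 \<tau> T) (map (\<lambda>y. y p) ?ys))"
    by (rule partially_computable_obj_app[OF length_cantor_context _ cantor_context_nth(4)
          denotable_args]) simp
  moreover have "obj_app (Fnl3 \<tau> T) (map (\<lambda>y. y p) ?ys) =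
      (case p of (F\<^sub>A, F\<^sub>Y, n) \<Rightarrow> T (map (\<lambda>x. x F\<^sub>A F\<^sub>Y) xs @ [Num n]))" for p
    using assms(2) by (simp add: case_prod_unfold comp_def)
  ultimately show ?thesis by simp
qed

lemma oracle_computes_cantor_realiser:
  assumes "\<forall>x \<in> set xs. denotable (cantor_context (Fnl3 \<tau> T)) (\<lambda>(F\<^sub>A, F\<^sub>Y, n). x F\<^sub>A F\<^sub>Y)"
    and "\<And>F\<^sub>A F\<^sub>Y. map (\<lambda>x. ty_of (x F\<^sub>A F\<^sub>Y)) xs @ [Ty0] = \<tau>"
    and "computable1 c" and termwise: "represents_real D (\<lambda>\<alpha> n. c (\<alpha> n)) g"
    and solution: "\<And>F\<^sub>A F\<^sub>Y A Y.
      \<lbrakk>represents_set {0..1} F\<^sub>A A; represents_nat {0..1} F\<^sub>Y Y; inj_on Y A\<rbrakk> \<Longrightarrow>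
        \<exists>z \<in> D. outputs_real T (map (\<lambda>x. x F\<^sub>A F\<^sub>Y) xs) z \<and> g z \<in> {0..1} - A"
  shows "computes_with_exists2 \<tau> T sig_cantor cantor_realiser"
proof -
  let ?f = "\<lambda>(F\<^sub>A, F\<^sub>Y, n). T (map (\<lambda>x. x F\<^sub>A F\<^sub>Y) xs @ [Num n])"
  have "partially_computable (\<lambda>p. map Low (cantor_input p) @ [Fnl3 \<tau> T, Low (Fnl exists2)])
      (\<lambda>p. map_option c (?f p))"
    using partially_computable_map_option[OF assms(3)
        partially_computable_oracle_cantor_context[OF assms(1,2)]]
    unfolding cantor_context_def .
  then obtain C where C: "kleene_computable_from sig_cantor C [Fnl3 \<tau> T, Low (Fnl exists2)]"
    "\<And>p m. map_option c (?f p) = Some m \<Longrightarrow> C (cantor_input p) = Some m"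
    by (rule partially_computable_imp_kleene_computable_from) blast
  have "\<exists>x \<in> {0..1} - A. outputs_real C [Fnl F\<^sub>A, Fnl F\<^sub>Y] x"
    if input: "represents_set {0..1} F\<^sub>A A" "represents_nat {0..1} F\<^sub>Y Y" "inj_on Y A"
    for F\<^sub>A F\<^sub>Y A and Y :: "real \<Rightarrow> nat"
  proof -
    obtain z where z: "z \<in> D" "outputs_real T (map (\<lambda>x. x F\<^sub>A F\<^sub>Y) xs) z" "g z \<in> {0..1} - A"
      using solution[OF input] by blast
    then obtain \<alpha> where \<alpha>: "names \<alpha> z" "\<And>n. T (map (\<lambda>x. x F\<^sub>A F\<^sub>Y) xs @ [Num n]) = Some (\<alpha> n)"
      unfolding outputs_real_def by blast
    then have "C ([Fnl F\<^sub>A, Fnl F\<^sub>Y] @ [Num n]) = Some (c (\<alpha> n))" for n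
      using C(2)[of "(F\<^sub>A, F\<^sub>Y, n)"] by (simp add: cantor_input_def)
    moreover have "names (\<lambda>n. c (\<alpha> n)) (g z)"
      using termwise \<alpha>(1) z(1) unfolding represents_real_def by blast
    ultimately have "outputs_real C [Fnl F\<^sub>A, Fnl F\<^sub>Y] (g z)" unfolding outputs_real_def by blast
    with z(3) show ?thesis by blast
  qed
  then have "cantor_realiser C" unfolding cantor_realiser_def by blast
  with C(1) show ?thesis unfolding computes_with_exists2_def by blast
qed

lemma represents_real_id: "represents_real D (\<lambda>\<alpha> n. \<alpha> n) (\<lambda>x. x)"
  by (simp add: represents_real_def)

lemma task1_computes_cantor_realiser:
  assumes incl: "includes_summable V" and task: "task1 V T"
  shows "computes_with_exists2 sig_pair T sig_cantor cantor_realiser"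
proof (rule oracle_computes_cantor_realiser[OF _ _ computable1_id represents_real_id])
  let ?xs = "[\<lambda>F\<^sub>A F\<^sub>Y. Fnl (weight_functional (\<lambda>n. n) F\<^sub>A F\<^sub>Y), \<lambda>F\<^sub>A F\<^sub>Y. Num 0]"
  have "denotable (cantor_context (Fnl3 sig_pair T)) (\<lambda>p. Num 0)"
    by (rule denotable_Num, rule computable_const, rule length_cantor_context)
  then show "\<forall>x \<in> set ?xs. denotable (cantor_context (Fnl3 sig_pair T)) (\<lambda>(F\<^sub>A, F\<^sub>Y, n). x F\<^sub>A F\<^sub>Y)"
    using denotable_weight_functional_cantor_context(1)[OF computable1_id] by simp
  fix F\<^sub>A F\<^sub>Y A Y
  assume repr_A: "represents_set {0..1} F\<^sub>A A" and repr_Y: "represents_nat {0..1} F\<^sub>Y Y"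
    and inj: "inj_on Y A"
  have "represents_rat {0..1} (weight_functional (\<lambda>n. n) F\<^sub>A F\<^sub>Y) (weight A Y)"
    using represents_rat_weight_functional[OF represents_real_id _ repr_A repr_Y] by simp
  moreover have "V 0 1 (\<lambda>x. real_of_rat (weight A Y x))"
    by (rule includes_summableD[OF incl _ summable_on_weight[OF inj]]) simp
  ultimately obtain x y where "x \<in> {0..1}" "x \<noteq> y" "weight A Y x = weight A Y y"
    "outputs_real_pair T [Fnl (weight_functional (\<lambda>n. n) F\<^sub>A F\<^sub>Y)] x y"
    using task unfolding task1_def by blast
  then show "\<exists>z \<in> {0..1}. outputs_real T (map (\<lambda>x. x F\<^sub>A F\<^sub>Y) ?xs) z \<and> z \<in> {0..1} - A"
    using weight_eq_imp_notin[OF inj] unfolding outputs_real_pair_def by auto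
qed simp

lemma real_oracle_computes_cantor_realiser:
  assumes solution: "\<And>F A Y.
    \<lbrakk>inj_on Y A; represents_real {0..1} F (\<lambda>x. real_of_rat (weight A Y x))\<rbrakk> \<Longrightarrow>
      \<exists>x \<in> {0..1} - A. outputs_real T [Op F] x"
  shows "computes_with_exists2 sig_real T sig_cantor cantor_realiser"
proof (rule oracle_computes_cantor_realiser[OF _ _ computable1_id represents_real_id])
  let ?xs = "[\<lambda>F\<^sub>A F\<^sub>Y. Op (\<lambda>\<alpha> j. weight_functional (\<lambda>n. n) F\<^sub>A F\<^sub>Y \<alpha>)]"
  show "\<forall>x \<in> set ?xs. denotable (cantor_context (Fnl3 sig_real T)) (\<lambda>(F\<^sub>A, F\<^sub>Y, n). x F\<^sub>A F\<^sub>Y)"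
    using denotable_weight_functional_cantor_context(2)[OF computable1_id] by simp
  fix F\<^sub>A F\<^sub>Y A Y
  assume repr_A: "represents_set {0..1} F\<^sub>A A" and repr_Y: "represents_nat {0..1} F\<^sub>Y Y"
    and inj: "inj_on Y A"
  have "represents_real {0..1} (\<lambda>\<alpha> j. weight_functional (\<lambda>n. n) F\<^sub>A F\<^sub>Y \<alpha>)
      (\<lambda>x. real_of_rat (weight A Y x))"
    using represents_rat_imp_represents_real[OF
        represents_rat_weight_functional[OF represents_real_id _ repr_A repr_Y]] by simp
  from solution[OF inj this]
  show "\<exists>z \<in> {0..1}. outputs_real T (map (\<lambda>x. x F\<^sub>A F\<^sub>Y) ?xs) z \<and> z \<in> {0..1} - A" by auto
qed simp

lemma task2_computes_cantor_realiser:
  assumes incl: "includes_summable V" and task: "task2 V T"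
  shows "computes_with_exists2 sig_real T sig_cantor cantor_realiser"
proof (rule real_oracle_computes_cantor_realiser)
  fix F A and Y :: "real \<Rightarrow> nat"
  let ?w = "\<lambda>x. real_of_rat (weight A Y x)"
  assume inj: "inj_on Y A" and repr_F: "represents_real {0..1} F ?w"
  have "V 0 1 ?w" by (rule includes_summableD[OF incl _ summable_on_weight[OF inj]]) simp
  then obtain x where x: "x \<in> {0..1}" "continuous (at x within {0..1}) ?w" "outputs_real T [Op F] x"
    using task repr_F unfolding task2_def by blast
  have "?w x = 0"
    using summable_on_continuous_imp_eq_0[OF summable_on_weight[OF inj] _ x(1,2)] by simp
  with x show "\<exists>x \<in> {0..1} - A. outputs_real T [Op F] x" by (auto simp: weight_eq_0_iff)
qed

lemma task3_computes_cantor_realiser: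
  assumes incl: "includes_summable V" and task: "task3 V T"
  shows "computes_with_exists2 sig_real T sig_cantor cantor_realiser"
proof (rule real_oracle_computes_cantor_realiser)
  fix F A and Y :: "real \<Rightarrow> nat"
  let ?w = "\<lambda>x. real_of_rat (weight A Y x)"
  assume inj: "inj_on Y A" and repr_F: "represents_real {0..1} F ?w"
  have "V 0 1 ?w" by (rule includes_summableD[OF incl _ summable_on_weight[OF inj]]) simp
  moreover have "has_riemann_integral ?w 0 1 0"
    using summable_on_weight[OF inj] by (rule summable_on_imp_has_riemann_integral_0)
  moreover have "?w ` {0..1} \<subseteq> {0..1}" using weight_in_unit_interval by blast
  ultimately obtain x where "x \<in> {0..1}" "?w x = 0" "outputs_real T [Op F] x"
    using task repr_F unfolding task3_def by blast
  then show "\<exists>x \<in> {0..1} - A. outputs_real T [Op F] x" by (auto simp: weight_eq_0_iff)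
qed

lemma task4_computes_cantor_realiser:
  assumes incl: "includes_summable V" and task: "task4 V T"
  shows "computes_with_exists2 sig_real2 T sig_cantor cantor_realiser"
proof (rule oracle_computes_cantor_realiser[OF _ _ computable1_squash_code represents_real_squash])
  let ?ctx = "cantor_context (Fnl3 sig_real2 T)"
  let ?F = "\<lambda>F\<^sub>A F\<^sub>Y \<alpha> (n :: nat). weight_functional squash_code F\<^sub>A F\<^sub>Y \<alpha>"
  let ?G = "\<lambda>(\<alpha> :: nat \<Rightarrow> nat) (n :: nat). rat_code 0"
  let ?xs = "[\<lambda>F\<^sub>A F\<^sub>Y. Op (?F F\<^sub>A F\<^sub>Y), \<lambda>F\<^sub>A F\<^sub>Y. Op ?G]"
  have "denotable ?ctx (\<lambda>p. Op ?G)"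
    by (rule denotable_Op, unfold case_prod_unfold, rule computable_const)
      (simp add: length_cantor_context)
  then show "\<forall>x \<in> set ?xs. denotable ?ctx (\<lambda>(F\<^sub>A, F\<^sub>Y, n). x F\<^sub>A F\<^sub>Y)"
    using denotable_weight_functional_cantor_context(2)[OF computable1_squash_code] by simp
  fix F\<^sub>A F\<^sub>Y A Y
  assume repr_A: "represents_set {0..1} F\<^sub>A A" and repr_Y: "represents_nat {0..1} F\<^sub>Y Y"
    and inj: "inj_on Y A"
  let ?f = "\<lambda>x. real_of_rat (weight A Y (squash x))"
  have "represents_real UNIV (?F F\<^sub>A F\<^sub>Y) ?f"
    using squash_in_unit_interval
    by (intro represents_rat_imp_represents_real
        represents_rat_weight_functional[OF represents_real_squash _ repr_A repr_Y]) blast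
  moreover have "represents_real UNIV ?G (\<lambda>_. 0)"
    using names_of_rat[of 0] by (simp add: represents_real_def)
  moreover have summable_f: "?f summable_on {0..}" using inj by (rule summable_on_weight_squash)
  then have "V 0 a ?f \<and> V 0 a (\<lambda>_. 0)" if "a > 0" for a
    using includes_summableD[OF incl that] summable_on_subset_banach[OF summable_f, of "{0..a}"]
    by simp
  moreover have "has_laplace_transform ?f s 0 \<and> has_laplace_transform (\<lambda>_. 0) s 0" if "s \<ge> 0" for s
    using summable_on_imp_has_laplace_transform_0[OF _ that] summable_f by simp
  ultimately obtain z where z: "?f z = 0" "outputs_real T [Op (?F F\<^sub>A F\<^sub>Y), Op ?G] z"
    using task unfolding task4_def by blast
  from z(1) have "squash z \<notin> A" by (simp add: weight_eq_0_iff)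
  with z(2) squash_in_unit_interval
  show "\<exists>z \<in> UNIV. outputs_real T (map (\<lambda>x. x F\<^sub>A F\<^sub>Y) ?xs) z \<and> squash z \<in> {0..1} - A" by auto
qed simp

lemma cantor_realiser_imp_weak: "cantor_realiser C \<Longrightarrow> weak_cantor_realiser C"
  unfolding cantor_realiser_def weak_cantor_realiser_def bij_betw_def by blast

lemma computes_weak_cantor_realiser:
  "computes_with_exists2 \<tau> T \<sigma> cantor_realiser \<Longrightarrow> computes_with_exists2 \<tau> T \<sigma> weak_cantor_realiser"
  unfolding computes_with_exists2_def using cantor_realiser_imp_weak by blast

section \<open>Task (1) from a NIN-realiser\<close>

lemma nin_realiser_imp_task1:
  assumes "nin_realiser N"
  shows "task1 V N"
  unfolding task1_def
proof (intro allI impI)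
  fix F and f :: "real \<Rightarrow> rat"
  assume "represents_rat {0..1} F f \<and> V 0 1 (\<lambda>x. real_of_rat (f x))"
  then have "represents_nat {0..1} F (\<lambda>x. rat_code (f x))" unfolding represents_rat_def by blast
  then obtain x y where "x \<in> {0..1}" "y \<in> {0..1}" "x \<noteq> y" "rat_code (f x) = rat_code (f y)"
    "outputs_real_pair N [Fnl F] x y"
    using assms unfolding nin_realiser_def by blast
  then show "\<exists>x \<in> {0..1}. \<exists>y \<in> {0..1}. x \<noteq> y \<and> f x = f y \<and> outputs_real_pair N [Fnl F] x y"
    using injD[OF inj_rat_code] by blast
qed

lemma computable_extension_of_sig_pair_oracle:
  obtains T where "kleene_computable_from sig_pair T [Fnl3 sig_pair N]"
    and "\<And>F i n m. N [Fnl F, Num i, Num n] = Some m \<Longrightarrow> T [Fnl F, Num i, Num n] = Some m"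
proof -
  let ?input = "\<lambda>p. [Fnl (fst p), Num (fst (snd p)), Num (snd (snd p))]"
  let ?A = "\<lambda>p. map Low (?input p) @ [Fnl3 sig_pair N]"
  have "denotable ?A (\<lambda>p. Fnl (fst p))"
    by (rule denotable_Fnl_argument[where k = 4 and i = 0]) auto
  moreover have "denotable ?A (\<lambda>p. Num (fst (snd p)))"
    by (rule denotable_Num, rule computable_Num[where k = 4 and i = 1]) auto
  moreover have "denotable ?A (\<lambda>p. Num (snd (snd p)))"
    by (rule denotable_Num, rule computable_Num[where k = 4 and i = 2]) auto
  ultimately have "partially_computable ?A (\<lambda>p. obj_app (Fnl3 sig_pair N)
      (map (\<lambda>x. x p) [\<lambda>p. Fnl (fst p), \<lambda>p. Num (fst (snd p)), \<lambda>p. Num (snd (snd p))]))"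
    by (intro partially_computable_obj_app[where k = 4 and i = 3]) auto
  then obtain T where T: "kleene_computable_from sig_pair T [Fnl3 sig_pair N]"
    "\<And>p m. obj_app (Fnl3 sig_pair N) (?input p) = Some m \<Longrightarrow> T (?input p) = Some m"
    by (rule partially_computable_imp_kleene_computable_from) auto
  from T(2)[of "(F, i, n)" for F i n]
  have "T [Fnl F, Num i, Num n] = Some m" if "N [Fnl F, Num i, Num n] = Some m" for F i n m
    using that by simp
  with T(1) show thesis by (rule that)
qed

lemma task1_mono:
  assumes "task1 V N"
    and "\<And>F i n m. N [Fnl F, Num i, Num n] = Some m \<Longrightarrow> T [Fnl F, Num i, Num n] = Some m"
  shows "task1 V T"
proof -
  have "outputs_real_pair T [Fnl F] x y" if "outputs_real_pair N [Fnl F] x y" for F x y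
    using that assms(2) unfolding outputs_real_pair_def outputs_real_def by fastforce
  with assms(1) show ?thesis unfolding task1_def by blast
qed

lemma nin_realiser_computes_task1:
  assumes "nin_realiser N"
  shows "\<exists>T. task1 V T \<and> kleene_computable_from sig_pair T [Fnl3 sig_pair N]"
  using computable_extension_of_sig_pair_oracle task1_mono[OF nin_realiser_imp_task1[OF assms]]
  by metis

theorem theorem3p12:
  shows "(\<forall>T.
      (task1 bounded_variation T \<longrightarrow> computes_with_exists2 sig_pair T sig_cantor cantor_realiser) \<and>
      (task2 bounded_variation T \<longrightarrow> computes_with_exists2 sig_real T sig_cantor cantor_realiser) \<and>
      (task3 riemann_integrable T \<longrightarrow> computes_with_exists2 sig_real T sig_cantor cantor_realiser) \<and>
      (task3 bounded_variation T \<longrightarrow> computes_with_exists2 sig_real T sig_cantor cantor_realiser) \<and>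
      (task4 bounded_variation T \<longrightarrow> computes_with_exists2 sig_real2 T sig_cantor cantor_realiser)) \<and>
    (\<forall>N. nin_realiser N \<longrightarrow>
      (\<exists>T. task1 bounded_variation T \<and> kleene_computable_from sig_pair T [Fnl3 sig_pair N])) \<and>
    (\<forall>T.
      (task1 has_variation T \<longrightarrow> computes_with_exists2 sig_pair T sig_cantor weak_cantor_realiser) \<and>
      (task2 has_variation T \<longrightarrow> computes_with_exists2 sig_real T sig_cantor weak_cantor_realiser) \<and>
      (task3 riemann_integrable T \<longrightarrow> computes_with_exists2 sig_real T sig_cantor weak_cantor_realiser) \<and>
      (task3 has_variation T \<longrightarrow> computes_with_exists2 sig_real T sig_cantor weak_cantor_realiser) \<and>
      (task4 has_variation T \<longrightarrow> computes_with_exists2 sig_real2 T sig_cantor weak_cantor_realiser))"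
proof -
  note tasks = task1_computes_cantor_realiser task2_computes_cantor_realiser
    task3_computes_cantor_realiser task4_computes_cantor_realiser
  note weak_tasks = tasks[THEN computes_weak_cantor_realiser]
  note computes = tasks[OF includes_summable_bounded_variation]
    tasks(3)[OF includes_summable_riemann_integrable]
    weak_tasks[OF includes_summable_has_variation]
    weak_tasks(3)[OF includes_summable_riemann_integrable]
  show ?thesis
    by (intro conjI allI impI) (erule computes nin_realiser_computes_task1)+
qed

end
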